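(* Let $\{X_i\}_{i\geq1}$ be a time-homogeneous Markov chain on $(\mathcal{X},\mathcal{B})$ with invariant probability measure $\pi$ and absolute spectral gap $1-\lambda>0$. Suppose the initial measure $\nu$ (the law of $X_1$) is absolutely continuous with respect to $\pi$ and its density $d\nu/d\pi$ has a finite $p$-moment for some $p\in(1,\infty]$, i.e. $$\infty>\left\|\frac{d\nu}{d\pi}\right\|_{\pi,p}:=\begin{cases}\left[\pi\left(\left|\frac{d\nu}{d\pi}\right|^p\right)\right]^{1/p}&\text{if }p<\infty,\\ \operatorname{ess\,sup}\left|\frac{d\nu}{d\pi}\right|&\text{if }p=\infty.\end{cases}$$ Let $q=p/(p-1)\in[1,\infty)$ (with $q=1$ if $p=\infty$). Then for any $n\ge1$, any bounded measurable functions $f_i:\mathcal{X}\to[a_i,b_i]$, $i=1,\dots,n$, and any $t\in\mathbb{R}$, $$\mathbb{E}_\nu\left[e^{t\sum_{i=1}^n(f_i(X_i)-\pi(f_i))}\right]\leq\left\|\frac{d\nu}{d\pi}\right\|_{\pi,p}\exp\left(\frac{t^2}{2}\cdot q\,\alpha(\lambda)\cdot\sum_{i=1}^n\frac{(b_i-a_i)^2}{4}\right).$$ It follows that for any $\epsilon>0$, $$\mathbb{P}_\nu\left(\left|\sum_{i=1}^n f_i(X_i)-\sum_{i=1}^n\pi(f_i)\right|>\epsilon\right)\leq2\left\|\frac{d\nu}{d\pi}\right\|_{\pi,p}\exp\left(-\frac{q^{-1}\alpha(\lambda)^{-1}\epsilon^2}{2\sum_{i=1}^n(b_i-a_i)^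2/4}\right).$$
   Context: The state space $(\mathcal{X},\mathcal{B})$ is a standard Borel space. A transition kernel $P$ is invariant with a probability measure $\pi$ if $\pi(B)=\int P(x,B)\,\pi(dx)$ for all $B\in\mathcal{B}$. $\mathcal{L}_2(\pi)$ is the real Hilbert space of $\pi$-square-integrable measurable real functions on $\mathcal{X}$, with norm $\|h\|_\pi=\pi(h^2)^{1/2}$, where $\pi(h):=\int h\,d\pi$. The kernel acts on $\mathcal{L}_2(\pi)$ as the Markov operator $Ph(x)=\int h(y)P(x,dy)$. The chain admits absolute spectral gap $1-\lambda$ if $\lambda:=\sup\{\|Ph\|_\pi:\|h\|_\pi=1,\ \pi(h)=0\}<1$. The chain is not assumed reversible. $\mathbb{E}_\nu$, $\mathbb{P}_\nu$ denote expectation and probability when $X_1\sim\nu$. $\alpha(\lambda)=\frac{1+\lambda}{1-\lambda}$. *)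

theory Defs
  imports "HOL-Probability.Probability"
begin

definition standard_borel :: "'a measure \<Rightarrow> bool" where
  "standard_borel M \<longleftrightarrow>
     (\<exists>T. completely_metrizable_space T \<and> second_countable T \<and> topspace T = space M \<and>
          sets M = sigma_sets (space M) {U. openin T U})"

definition invariant_measure :: "('a \<Rightarrow> 'a measure) \<Rightarrow> 'a measure \<Rightarrow> bool" where
  "invariant_measure P \<pi> \<longleftrightarrow> (\<forall>B\<in>sets \<pi>. emeasure \<pi> B = (\<integral>\<^sup>+x. emeasure (P x) B \<partial>\<pi>))"

definition markov_op :: "('a \<Rightarrow> 'a measure) \<Rightarrow> ('a \<Rightarrow> real) \<Rightarrow> 'a \<Rightarrow> real" where
  "markov_op P h x = (\<integral>y. h y \<partial>P x)"

definition L2_space :: "'a measure \<Rightarrow> ('a \<Rightarrow> real) set" where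
  "L2_space \<pi> = {h \<in> borel_measurable \<pi>. integrable \<pi> (\<lambda>x. (h x)\<^sup>2)}"

definition L2_norm :: "'a measure \<Rightarrow> ('a \<Rightarrow> real) \<Rightarrow> real" where
  "L2_norm \<pi> h = sqrt (\<integral>x. (h x)\<^sup>2 \<partial>\<pi>)"

(* The element 0 only fixes the value of the supremum over the empty set, which occurs exactly
   when every mean-zero function in L2 vanishes almost everywhere. If P leaves \<pi> invariant, the
   remaining elements lie in [0,1] because the operator is a contraction, so the real-valued
   supremum is the true one. *)
definition spectral_lambda :: "'a measure \<Rightarrow> ('a \<Rightarrow> 'a measure) \<Rightarrow> real" where
  "spectral_lambda \<pi> P =
     Sup (insert 0 {L2_norm \<pi> (markov_op P h) | h.
                      h \<in> L2_space \<pi> \<and> L2_norm \<pi> h = 1 \<and> (\<integral>x. h x \<partial>\<pi>) = 0})"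

definition alpha :: "real \<Rightarrow> real" where
  "alpha l = (1 + l) / (1 - l)"

definition natural_filtration ::
    "'w measure \<Rightarrow> 'a measure \<Rightarrow> (nat \<Rightarrow> 'w \<Rightarrow> 'a) \<Rightarrow> nat \<Rightarrow> 'w measure" where
  "natural_filtration \<Omega> M X n =
     sigma (space \<Omega>) (\<Union>i\<in>{1..n}. {X i -` A \<inter> space \<Omega> | A. A \<in> sets M})"

(* Time starts at 1, and the variable X 0 plays no role. *)
definition markov_chain ::
    "'w measure \<Rightarrow> 'a measure \<Rightarrow> ('a \<Rightarrow> 'a measure) \<Rightarrow> 'a measure \<Rightarrow> (nat \<Rightarrow> 'w \<Rightarrow> 'a) \<Rightarrow> bool" where
  "markov_chain \<Omega> M P \<nu> X \<longleftrightarrow>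
     prob_space \<Omega> \<and>
     P \<in> M \<rightarrow>\<^sub>M prob_algebra M \<and>
     (\<forall>n\<ge>1. X n \<in> \<Omega> \<rightarrow>\<^sub>M M) \<and>
     distr \<Omega> M (X 1) = \<nu> \<and>
     (\<forall>n\<ge>1. \<forall>B\<in>sets M. AE \<omega> in \<Omega>.
        real_cond_exp \<Omega> (natural_filtration \<Omega> M X n) (\<lambda>\<omega>'. indicat_real B (X (Suc n) \<omega>')) \<omega>
          = measure (P (X n \<omega>)) B)"

(* The norm takes the value \<infinity> when the p-th moment is infinite. *)
definition Lp_norm :: "'a measure \<Rightarrow> ennreal \<Rightarrow> ('a \<Rightarrow> real) \<Rightarrow> ennreal" where
  "Lp_norm \<pi> p g =
     (if p = \<infinity> then esssup \<pi> (\<lambda>x. ennreal \<bar>g x\<bar>)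
      else let I = (\<integral>\<^sup>+x. ennreal (\<bar>g x\<bar> powr enn2real p) \<partial>\<pi>)
           in if I = \<infinity> then \<infinity> else ennreal (enn2real I powr (1 / enn2real p)))"

(* RN_deriv is ennreal-valued. If \<nu> is a probability measure, it is finite almost everywhere,
   so the coercion to the reals changes it on a null set only. *)
definition density_norm :: "'a measure \<Rightarrow> 'a measure \<Rightarrow> ennreal \<Rightarrow> ennreal" where
  "density_norm \<pi> \<nu> p = Lp_norm \<pi> p (\<lambda>x. enn2real (RN_deriv \<pi> \<nu> x))"

definition conjugate_exponent :: "ennreal \<Rightarrow> real" where
  "conjugate_exponent p = (if p = \<infinity> then 1 else enn2real p / (enn2real p - 1))"

end

theory Submission
  imports Defs
begin

text \<open>
  Writing \<open>v k x\<close> for the conditional expectation of \<open>exp (\<Sum>i\<ge>k. g i (X i))\<close> given \<open>X k = x\<close>, one has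
  \<open>v k = exp (g k) * P (v (k + 1))\<close>. The spectral gap gives \<open>\<langle>h, P v\<rangle>\<^sup>2 \<le> Q h * Q v\<close>, where
  \<open>Q h = \<lambda> \<pi>(h\<^sup>2) + (1 - \<lambda>) \<pi>(h)\<^sup>2\<close> is the form of the Leon--Perron operator. It remains to bound
  \<open>Q (exp g * u)\<close> by \<open>exp (\<alpha> (b - a)\<^sup>2 / 8) * \<pi> (exp g * u\<^sup>2)\<close> for a centred \<open>g\<close> with values in
  \<open>[a, b]\<close>. By convexity of a resolvent this is a statement about two-point distributions, namely
  \<open>\<alpha> cosh r + d sinh r \<le> \<alpha> cosh B + sinh B\<close> with \<open>B = d r + \<alpha> r\<^sup>2 / 2\<close>, which follows from its case
  \<open>\<alpha> = 1\<close> (Hoeffding's lemma) and \<open>cosh r - r sinh r / 2 \<le> 1\<close>. A general initial law is reduced to the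
  stationary one by the inequalities of Hoelder and Jensen.
\<close>

section \<open>Two-point distributions\<close>

text \<open>Without reversibility \<open>P\<close> offers no spectral decomposition, and the
  functions change from one time to the next, so no single symmetric operator can be iterated. The
  induction is arranged to need only the bilinear estimate on \<open>h\<close> and
  \<open>P v\<close>: since \<open>v k\<close> is exp (g k) times \<open>P (v (k + 1))\<close>, the
  quantity pi (exp (g k) * (P (v (k + 1)))^2) is itself the inner product of \<open>v k\<close> with
  \<open>P (v (k + 1))\<close>. Hence Q (v k) reappears on the right under a square root and
  cancels, leaving Q (v k) <= K^2 * Q (v (k + 1)). The resolvent has the following origin. The
  inequality Q (exp g * u) <= K * pi (exp g * u^2) compares a multiplication operator with a
  rank-one term. If K exceeds lambda * exp g uniformly, it holds for all u exactly when (1 - lambda)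
  * pi (exp g / (K - lambda * exp g)) <= 1. The integrand is a convex function of g, so among
  centred laws on [a, b] the one carried by the two endpoints is the worst.\<close>

lemma cosh_minus_half_sinh_le_1:
  fixes r :: real
  assumes "r \<ge> 0"
  shows "cosh r - r * sinh r / 2 \<le> 1"
proof -
  \<comment> \<open>This gives the sign of the derivative (sinh y - y * cosh y) / 2 of the function
    in the claim.\<close>
  have tanh: "sinh x \<le> x * cosh x" if "x \<ge> 0" for x :: real
  proof -
    have "(\<lambda>x. x * cosh x - sinh x) 0 \<le> (\<lambda>x. x * cosh x - sinh x) (x::real)"
    proof (rule DERIV_nonneg_imp_nondecreasing[OF that])
      fix y :: real assume "0 \<le> y" "y \<le> x"
      then show "\<exists>D. ((\<lambda>x. x * cosh x - sinh x) has_real_derivative D) (at y) \<and> D \<ge> 0"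
        by (intro exI[of _ "y * sinh y"]) (auto intro!: derivative_eq_intros)
    qed
    then show ?thesis by simp
  qed
  have "(\<lambda>x. cosh x - x * sinh x / 2) r \<le> (\<lambda>x. cosh x - x * sinh x / 2) (0::real)"
  proof (rule DERIV_nonpos_imp_nonincreasing[OF assms])
    fix y :: real assume "0 \<le> y" "y \<le> r"
    then show "\<exists>D. ((\<lambda>x. cosh x - x * sinh x / 2) has_real_derivative D) (at y) \<and> D \<le> 0"
      using tanh[of y]
      by (intro exI[of _ "(sinh y - y * cosh y) / 2"])
        (auto intro!: derivative_eq_intros simp: field_simps)
  qed
  then show ?thesis by simp
qed

lemma cosh_plus_sinh_pos:
  fixes d x :: real
  assumes "d \<ge> -1" "x \<ge> 0"
  shows "cosh x + d * sinh x > 0"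
proof -
  have "cosh x + d * sinh x \<ge> cosh x + (-1) * sinh x"
    using assms by (intro add_left_mono mult_right_mono) auto
  moreover have "cosh x + (-1) * sinh x = exp (-x)"
    by (simp add: cosh_minus_sinh)
  ultimately show ?thesis
    by (smt (verit) exp_gt_zero)
qed

text \<open>For d in [-1, 1] the left side is the moment generating function of the law on {-1, 1}
  with mean d. The logarithmic derivative \<open>y\<close> is the mean of the tilted law, and its
  derivative 1 - y^2 is the variance, at most 1. The bound 1 - y^2 <= 1 survives for d > 1, where no
  law is left; the shifted slope \<open>d'\<close> of the next lemma can enter that range.\<close>

lemma cosh_plus_sinh_le_exp:
  fixes d r :: real
  assumes d: "d \<ge> -1" and r: "r \<ge> 0"
  shows "cosh r + d * sinh r \<le> exp (d * r + r\<^sup>2 / 2)"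
proof -
  define y where "y = (\<lambda>x::real. (sinh x + d * cosh x) / (cosh x + d * sinh x))"
  note pos = cosh_plus_sinh_pos[OF d]
  have y_le: "y x \<le> d + x" if x: "x \<ge> 0" for x
  proof -
    have "(\<lambda>x. d + x - y x) 0 \<le> (\<lambda>x. d + x - y x) x"
    proof (rule DERIV_nonneg_imp_nondecreasing[OF x])
      fix z :: real assume "0 \<le> z" "z \<le> x"
      then have p: "cosh z + d * sinh z > 0" using pos by simp
      have "(y has_real_derivative 1 - (y z)\<^sup>2) (at z)"
        unfolding y_def using p
        by (auto intro!: derivative_eq_intros)
          (simp add: power2_eq_square diff_divide_distrib mult.commute)
      then have "((\<lambda>x. d + x - y x) has_real_derivative (y z)\<^sup>2) (at z)"
        by (auto intro!: derivative_eq_intros)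
      then show "\<exists>D. ((\<lambda>x. d + x - y x) has_real_derivative D) (at z) \<and> D \<ge> 0"
        by (intro exI[of _ "(y z)\<^sup>2"]) auto
    qed
    then show ?thesis by (simp add: y_def)
  qed
  have "(\<lambda>x. d * x + x\<^sup>2 / 2 - ln (cosh x + d * sinh x)) 0
      \<le> (\<lambda>x. d * x + x\<^sup>2 / 2 - ln (cosh x + d * sinh x)) r"
  proof (rule DERIV_nonneg_imp_nondecreasing[OF r])
    fix z :: real assume z: "0 \<le> z" "z \<le> r"
    then have "((\<lambda>x. d * x + x\<^sup>2 / 2 - ln (cosh x + d * sinh x)) has_real_derivative d + z - y z) (at z)"
      unfolding y_def using pos[of z]
      by (auto intro!: derivative_eq_intros simp: field_simps power2_eq_square)
    then show "\<exists>D. ((\<lambda>x. d * x + x\<^sup>2 / 2 - ln (cosh x + d * sinh x)) has_real_derivative D) (at z) \<and> D \<ge> 0"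
      using y_le[OF z(1)] by (intro exI[of _ "d + z - y z"]) auto
  qed
  then have "ln (cosh r + d * sinh r) \<le> d * r + r\<^sup>2 / 2" by simp
  then have "exp (ln (cosh r + d * sinh r)) \<le> exp (d * r + r\<^sup>2 / 2)" by simp
  then show ?thesis using pos[OF r] by simp
qed

lemma cosh_sinh_quadratic_bound:
  fixes c d r :: real
  assumes c: "c \<ge> 1" and d: "d \<ge> -1" and r: "r \<ge> 0"
  defines "B \<equiv> d * r + c * r\<^sup>2 / 2"
  shows "c * cosh r + d * sinh r \<le> c * cosh B + sinh B"
proof -
  \<comment> \<open>The slope for which the exponent d' * r + r^2 / 2 of the case c = 1 becomes
    exactly \<open>B\<close>. The shift costs the term (c - 1) * r * sinh r / 2, and (c - 1) copies
    of cosh r - r * sinh r / 2 <= 1 <= cosh B pay for it.\<close>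
  define d' where "d' = d + (c - 1) * r / 2"
  have d': "d' \<ge> -1"
  proof -
    have "(c - 1) * r / 2 \<ge> 0" using c r by simp
    then show ?thesis using d by (simp add: d'_def)
  qed
  have "cosh r + d' * sinh r \<le> exp (d' * r + r\<^sup>2 / 2)"
    by (rule cosh_plus_sinh_le_exp[OF d' r])
  also have "d' * r + r\<^sup>2 / 2 = B"
    by (simp add: d'_def B_def power2_eq_square field_simps)
  also have "exp B = cosh B + sinh B"
    by (simp add: cosh_plus_sinh)
  finally have 1: "cosh r + d * sinh r + (c - 1) * (r * sinh r / 2) \<le> cosh B + sinh B"
    by (simp add: d'_def algebra_simps)
  have "cosh r - r * sinh r / 2 \<le> cosh B"
    using cosh_minus_half_sinh_le_1[OF r] cosh_real_ge_1[of B] by linarith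
  then have "(c - 1) * (cosh r - r * sinh r / 2) \<le> (c - 1) * cosh B"
    using c by (intro mult_left_mono) auto
  with 1 show ?thesis by (simp add: algebra_simps)
qed

section \<open>The constant alpha and the resolvent of a two-point law\<close>

lemma alpha_ge_1: "0 \<le> l \<Longrightarrow> l < 1 \<Longrightarrow> alpha l \<ge> 1"
  by (simp add: alpha_def)

text \<open>The right side is the [1/1] Pade approximant of ln at 1. The difference vanishes at 1
  and has a positive derivative before it. At x = l the approximant equals -2 / alpha l.\<close>

lemma ln_less_pade:
  fixes x :: real
  assumes "0 < x" "x < 1"
  shows "ln x < 2 * (x - 1) / (x + 1)"
proof -
  have "(\<lambda>x. ln x - 2 * (x - 1) / (x + 1)) x < (\<lambda>x. ln x - 2 * (x - 1) / (x + 1)) 1"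
  proof (rule DERIV_pos_imp_increasing_open[OF assms(2)])
    fix y assume y: "x < y" "y < 1"
    have "((\<lambda>x. ln x - 2 * (x - 1) / (x + 1)) has_real_derivative (y - 1)\<^sup>2 / (y * (y + 1)\<^sup>2)) (at y)"
      using y assms
      by (auto intro!: derivative_eq_intros, simp add: divide_simps)
        (simp add: algebra_simps power2_eq_square)
    then show "\<exists>D. ((\<lambda>x. ln x - 2 * (x - 1) / (x + 1)) has_real_derivative D) (at y) \<and> 0 < D"
      using y assms by (intro exI[of _ "(y - 1)\<^sup>2 / (y * (y + 1)\<^sup>2)"]) auto
  next
    show "continuous_on {x..1} (\<lambda>x. ln x - 2 * (x - 1) / (x + 1))"
      using assms by (intro continuous_intros) auto
  qed
  then show ?thesis by simp
qed

text \<open>Keeps the denominators K - l * exp x positive: with s the length of an interval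
  containing 0, every point x of it satisfies x <= s.\<close>

lemma mult_exp_less_exp_alpha:
  fixes l s :: real
  assumes l: "0 \<le> l" "l < 1"
  shows "l * exp s < exp (alpha l * s\<^sup>2 / 8)"
proof (cases "l = 0")
  case False
  with l have l0: "l > 0" by simp
  have a0: "alpha l > 0" using alpha_ge_1[OF l] by simp
  \<comment> \<open>Completing the square: alpha * s^2 / 8 - s has its minimum -2 / alpha at s = 4 /
    alpha.\<close>
  have "(alpha l * s / 4 - 1)\<^sup>2 \<ge> 0" by simp
  then have "2 / alpha l * (alpha l * s / 4 - 1)\<^sup>2 \<ge> 0"
    using a0 by simp
  also have "2 / alpha l * (alpha l * s / 4 - 1)\<^sup>2 = alpha l * s\<^sup>2 / 8 - s + 2 / alpha l"
    using a0 by (simp add: power2_eq_square field_simps)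
  finally have "s - 2 / alpha l \<le> alpha l * s\<^sup>2 / 8"
    by simp
  moreover have "ln l < - 2 / alpha l"
    using ln_less_pade[OF l0 l(2)] l by (simp add: alpha_def field_simps)
  ultimately have "ln l + s < alpha l * s\<^sup>2 / 8" by simp
  then have "exp (ln l + s) < exp (alpha l * s\<^sup>2 / 8)" by simp
  then show ?thesis using l0 by (simp add: exp_add)
qed auto

text \<open>After division by u + v, the left side is (1 - l) times the mean of exp x / (K - l * exp
  x) under the centred law on {-u, v}, with masses v / (u + v) and u / (u + v). Clearing
  denominators and centring the interval turns the claim into the hyperbolic inequality with c =
  alpha l.\<close>

lemma two_point_bound:
  fixes l u v :: real
  assumes l: "0 \<le> l" "l < 1" and uv: "u \<ge> 0" "v \<ge> 0" "u + v > 0"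
  defines "K \<equiv> exp (alpha l * (u + v)\<^sup>2 / 8)"
  shows "v * ((1 - l) * exp (-u) / (K - l * exp (-u))) + u * ((1 - l) * exp v / (K - l * exp v)) \<le> u + v"
proof -
  \<comment> \<open>\<open>r\<close> is half the length of [-u, v], and \<open>d\<close> is the mass
    at v minus the mass at -u.\<close>
  define r where "r = (u + v) / 2"
  define d where "d = (u - v) / (u + v)"
  define B where "B = d * r + alpha l * r\<^sup>2 / 2"
  have r: "r > 0" and d: "d \<ge> -1" using uv by (auto simp: r_def d_def field_simps)
  have "l * exp v \<le> l * exp (u + v)" "l * exp (-u) \<le> l * exp (u + v)"
    using l uv by (auto intro!: mult_left_mono)
  with mult_exp_less_exp_alpha[OF l, of "u + v"]
  have pos: "K - l * exp v > 0" "K - l * exp (-u) > 0" by (auto simp: K_def)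
  have dr: "d * r = (u - v) / 2" using uv by (simp add: d_def r_def)
  have K: "exp B = K * exp ((u - v) / 2)"
    unfolding B_def dr K_def by (simp add: exp_add r_def power_divide)
  have key: "alpha l * cosh r + d * sinh r \<le> alpha l * cosh B + sinh B"
    unfolding B_def using cosh_sinh_quadratic_bound[of "alpha l" d r] alpha_ge_1[OF l] r d by simp
  then have "(1 - l) * (alpha l * cosh r + d * sinh r) \<le> (1 - l) * (alpha l * cosh B + sinh B)"
    using l by (intro mult_left_mono) auto
  moreover have "(1 - l) * (alpha l * x + y) = (1 + l) * x + (1 - l) * y" for x y
    using l by (simp add: alpha_def distrib_left)
  ultimately have "(1 + l) * cosh r + (1 - l) * d * sinh r \<le> (1 + l) * cosh B + (1 - l) * sinh B"
    by (simp add: mult.assoc)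
  also have "\<dots> = exp B + l * exp (-B)"
    by (simp add: cosh_def sinh_def field_simps)
  finally have "exp B * ((1 + l) * cosh r + (1 - l) * d * sinh r) \<le> exp B * (exp B + l * exp (-B))"
    by (intro mult_left_mono) auto
  also have "\<dots> = (exp B)\<^sup>2 + l"
    by (simp add: algebra_simps power2_eq_square flip: exp_add)
  finally have *: "(u + v) * (exp B * ((1 + l) * cosh r + (1 - l) * d * sinh r)) \<le> (u + v) * ((exp B)\<^sup>2 + l)"
    using uv by (intro mult_left_mono) auto
  then have "exp B * ((u + v) * (1 + l) * cosh r + (1 - l) * (u - v) * sinh r) \<le> (u + v) * ((exp B)\<^sup>2 + l)"
  proof -
    have "(u + v) * d = u - v" using uv by (simp add: d_def)
    then have "(u + v) * (exp B * ((1 + l) * cosh r + (1 - l) * d * sinh r))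
        = exp B * ((u + v) * (1 + l) * cosh r + (1 - l) * (u - v) * sinh r)"
      by (simp only: flip: \<open>(u + v) * d = u - v\<close>) (simp add: algebra_simps)
    with * show ?thesis by (simp only:)
  qed
  \<comment> \<open>As exp B = K * exp ((u - v) / 2), this factor turns (exp B)^2 into K^2, and exp
    B * exp r and exp B * exp (-r) into K * exp v and K * exp (-u).\<close>
  then have "exp (v - u) * (exp B * ((u + v) * (1 + l) * cosh r + (1 - l) * (u - v) * sinh r))
     \<le> exp (v - u) * ((u + v) * ((exp B)\<^sup>2 + l))"
    by (intro mult_left_mono) auto
  moreover have "exp (v - u) * (exp B * ((u + v) * (1 + l) * cosh r + (1 - l) * (u - v) * sinh r))
      = K * ((l * (u + v) + (1 - l) * v) * exp (-u) + (l * (u + v) + (1 - l) * u) * exp v)"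
  proof -
    have 1: "exp (v - u) * exp B * exp r = K * exp v"
      unfolding K r_def by (simp add: field_simps flip: exp_add)
    have 2: "exp (v - u) * exp B * exp (-r) = K * exp (-u)"
      unfolding K r_def by (simp add: field_simps flip: exp_add)
    have "exp (v - u) * (exp B * ((u + v) * (1 + l) * cosh r + (1 - l) * (u - v) * sinh r)) =
       ((u + v) * (1 + l) + (1 - l) * (u - v)) / 2 * (exp (v - u) * exp B * exp r)
       + ((u + v) * (1 + l) - (1 - l) * (u - v)) / 2 * (exp (v - u) * exp B * exp (-r))"
      by (simp add: cosh_def sinh_def field_simps)
    also have "\<dots> = K * ((l * (u + v) + (1 - l) * v) * exp (-u) + (l * (u + v) + (1 - l) * u) * exp v)"
      unfolding 1 2 by (simp add: field_simps)
    finally show ?thesis .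
  qed
  moreover have "exp (v - u) * ((u + v) * ((exp B)\<^sup>2 + l)) = (u + v) * (K\<^sup>2 + l * (exp v * exp (-u)))"
    unfolding K by (simp add: field_simps power2_eq_square flip: exp_add)
  ultimately have "K * ((l * (u + v) + (1 - l) * v) * exp (-u) + (l * (u + v) + (1 - l) * u) * exp v)
     \<le> (u + v) * (K\<^sup>2 + l * (exp v * exp (-u)))" by simp
  then have "v * ((1 - l) * exp (-u)) * (K - l * exp v) + u * ((1 - l) * exp v) * (K - l * exp (-u))
     \<le> (u + v) * ((K - l * exp (-u)) * (K - l * exp v))"
    by (simp add: algebra_simps power2_eq_square)
  then show ?thesis
    using pos by (simp add: divide_simps)
qed

text \<open>Convexity places the resolvent below its chord, whose mean under a centred law depends
  on the endpoints only.\<close>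

lemma convex_on_resolvent_exp:
  fixes l K A B :: real
  assumes l: "0 \<le> l" and K: "\<And>x. x \<in> {A..B} \<Longrightarrow> l * exp x < K"
  shows "convex_on {A..B} (\<lambda>x. exp x / (K - l * exp x))"
proof (rule f''_ge0_imp_convex)
  fix x assume x: "x \<in> {A..B}"
  with K have p: "K - l * exp x > 0" by simp
  show "((\<lambda>x. exp x / (K - l * exp x)) has_real_derivative K * exp x / (K - l * exp x)\<^sup>2) (at x)"
    using p by (auto intro!: derivative_eq_intros simp: field_simps power2_eq_square)
  show "((\<lambda>x. K * exp x / (K - l * exp x)\<^sup>2) has_real_derivative
      K * exp x * (K + l * exp x) / (K - l * exp x) ^ 3) (at x)"
  proof -
    define D where "D = K - l * exp x"
    have "((\<lambda>x. K * exp x / (K - l * exp x)\<^sup>2) has_real_derivative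
        (K * exp x * D\<^sup>2 + K * exp x * (2 * D * (l * exp x))) / (D\<^sup>2 * D\<^sup>2)) (at x)"
      using p unfolding D_def by (auto intro!: derivative_eq_intros simp: algebra_simps)
    also have "(K * exp x * D\<^sup>2 + K * exp x * (2 * D * (l * exp x))) / (D\<^sup>2 * D\<^sup>2)
        = K * exp x * (D + 2 * (l * exp x)) / D ^ 3"
      using p unfolding D_def[symmetric] by (simp add: field_simps power2_eq_square power3_eq_cube)
    finally show ?thesis by (simp add: D_def add.commute)
  qed
  have "K \<ge> 0" using p l by (smt (verit) exp_gt_zero mult_nonneg_nonneg)
  then show "K * exp x * (K + l * exp x) / (K - l * exp x) ^ 3 \<ge> 0"
    using p l by simp
qed simp

section \<open>Bounded functions and the Leon--Perron operator\<close>

text \<open>Bounded everywhere and not merely almost everywhere: \<open>P x\<close> may charge null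
  sets of \<open>\<pi>\<close>. The class depends only on the sigma-algebra, so it is the same for
  \<open>M\<close>, \<open>\<pi>\<close> and every \<open>P x\<close>, and its members are
  integrable under each of these probability measures.\<close>

definition bounded_fun :: "'a measure \<Rightarrow> ('a \<Rightarrow> real) set" where
  "bounded_fun M = {f \<in> borel_measurable M. \<exists>C. \<forall>x\<in>space M. \<bar>f x\<bar> \<le> C}"

lemma bounded_funI:
  "f \<in> borel_measurable M \<Longrightarrow> (\<And>x. x \<in> space M \<Longrightarrow> \<bar>f x\<bar> \<le> C) \<Longrightarrow> f \<in> bounded_fun M"
  by (auto simp: bounded_fun_def)

lemma bounded_fun_measurable: "f \<in> bounded_fun M \<Longrightarrow> f \<in> borel_measurable M"
  by (simp add: bounded_fun_def)

lemma bounded_funE: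
  assumes "f \<in> bounded_fun M"
  obtains C where "C \<ge> 0" "\<And>x. x \<in> space M \<Longrightarrow> \<bar>f x\<bar> \<le> C"
proof -
  obtain C where C: "\<And>x. x \<in> space M \<Longrightarrow> \<bar>f x\<bar> \<le> C"
    using assms by (auto simp: bounded_fun_def)
  show ?thesis by (rule that[of "max 0 C"]) (use C in \<open>auto simp: max.coboundedI2\<close>)
qed

lemma bounded_fun_cong_sets:
  assumes "sets M = sets N"
  shows "bounded_fun M = bounded_fun N"
  unfolding bounded_fun_def sets_eq_imp_space_eq[OF assms] measurable_cong_sets[OF assms refl] ..

lemma bounded_fun_const: "(\<lambda>x. c) \<in> bounded_fun M"
  by (rule bounded_funI[of _ _ "\<bar>c\<bar>"]) auto

lemma bounded_fun_add:
  assumes f: "f \<in> bounded_fun M" and g: "g \<in> bounded_fun M"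
  shows "(\<lambda>x. f x + g x) \<in> bounded_fun M"
proof -
  obtain C where C: "C \<ge> 0" "\<And>x. x \<in> space M \<Longrightarrow> \<bar>f x\<bar> \<le> C" using bounded_funE[OF f] by blast
  obtain D where D: "D \<ge> 0" "\<And>x. x \<in> space M \<Longrightarrow> \<bar>g x\<bar> \<le> D" using bounded_funE[OF g] by blast
  show ?thesis
  proof (rule bounded_funI)
    show "(\<lambda>x. f x + g x) \<in> borel_measurable M"
      using f g by (intro borel_measurable_add bounded_fun_measurable)
    show "\<bar>f x + g x\<bar> \<le> C + D" if "x \<in> space M" for x
      using C(2)[OF that] D(2)[OF that] by linarith
  qed
qed

lemma bounded_fun_mult:
  assumes f: "f \<in> bounded_fun M" and g: "g \<in> bounded_fun M"
  shows "(\<lambda>x. f x * g x) \<in> bounded_fun M"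
proof -
  obtain C where C: "C \<ge> 0" "\<And>x. x \<in> space M \<Longrightarrow> \<bar>f x\<bar> \<le> C" using bounded_funE[OF f] by blast
  obtain D where D: "D \<ge> 0" "\<And>x. x \<in> space M \<Longrightarrow> \<bar>g x\<bar> \<le> D" using bounded_funE[OF g] by blast
  show ?thesis
  proof (rule bounded_funI)
    show "(\<lambda>x. f x * g x) \<in> borel_measurable M"
      using f g by (intro borel_measurable_times bounded_fun_measurable)
    show "\<bar>f x * g x\<bar> \<le> C * D" if "x \<in> space M" for x
      using C D that by (simp add: abs_mult mult_mono)
  qed
qed

lemma bounded_fun_cmult: "f \<in> bounded_fun M \<Longrightarrow> (\<lambda>x. c * f x) \<in> bounded_fun M"
  by (intro bounded_fun_mult bounded_fun_const)

lemma bounded_fun_diff: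
  "f \<in> bounded_fun M \<Longrightarrow> g \<in> bounded_fun M \<Longrightarrow> (\<lambda>x. f x - g x) \<in> bounded_fun M"
  using bounded_fun_add[of f M "\<lambda>x. (-1) * g x"] bounded_fun_cmult[of g M "-1"] by simp

lemma bounded_fun_power: "f \<in> bounded_fun M \<Longrightarrow> (\<lambda>x. f x ^ k) \<in> bounded_fun M"
  by (induction k) (auto intro: bounded_fun_const bounded_fun_mult)

lemma bounded_fun_exp:
  assumes f: "f \<in> bounded_fun M"
  shows "(\<lambda>x. exp (f x)) \<in> bounded_fun M"
proof -
  obtain C where "C \<ge> 0" "\<And>x. x \<in> space M \<Longrightarrow> \<bar>f x\<bar> \<le> C" using bounded_funE[OF f] by blast
  then show ?thesis
    using f by (intro bounded_funI[of _ _ "exp C"]) (auto dest!: bounded_fun_measurable simp: abs_le_iff)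
qed

lemma bounded_fun_compose:
  assumes f: "f \<in> bounded_fun M" and T: "T \<in> N \<rightarrow>\<^sub>M M"
  shows "(\<lambda>x. f (T x)) \<in> bounded_fun N"
proof -
  obtain C where "C \<ge> 0" "\<And>x. x \<in> space M \<Longrightarrow> \<bar>f x\<bar> \<le> C" using bounded_funE[OF f] by blast
  then show ?thesis
    using f T by (intro bounded_funI[of _ _ C]) (auto dest!: bounded_fun_measurable dest: measurable_space)
qed

lemmas bounded_fun_intros = bounded_fun_const bounded_fun_add bounded_fun_mult bounded_fun_diff
  bounded_fun_power bounded_fun_exp

section \<open>Quadratic inequalities under a fixed probability measure\<close>

context prob_space
begin

lemma integrable_bounded_fun: "f \<in> bounded_fun M \<Longrightarrow> integrable M f"
  by (auto simp: bounded_fun_def intro!: integrable_const_bound AE_I2)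

lemma Cauchy_Schwarz_bounded_fun:
  assumes f: "f \<in> bounded_fun M" and g: "g \<in> bounded_fun M"
  shows "(expectation (\<lambda>x. f x * g x))\<^sup>2 \<le> expectation (\<lambda>x. (f x)\<^sup>2) * expectation (\<lambda>x. (g x)\<^sup>2)"
proof -
  note [simp] = integrable_bounded_fun[OF bounded_fun_mult[OF f g]]
    integrable_bounded_fun[OF bounded_fun_power[OF f]] integrable_bounded_fun[OF bounded_fun_power[OF g]]
  define F where "F = expectation (\<lambda>x. (f x)\<^sup>2)"
  define G where "G = expectation (\<lambda>x. (g x)\<^sup>2)"
  define S where "S = expectation (\<lambda>x. f x * g x)"
  have FG: "F \<ge> 0" "G \<ge> 0" by (auto simp: F_def G_def)
  have quad: "c\<^sup>2 * F - 2 * c * S + G \<ge> 0" for c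
  proof -
    have "0 \<le> expectation (\<lambda>x. (c * f x - g x)\<^sup>2)" by simp
    also have "expectation (\<lambda>x. (c * f x - g x)\<^sup>2)
        = expectation (\<lambda>x. c\<^sup>2 * (f x)\<^sup>2 - 2 * c * (f x * g x) + (g x)\<^sup>2)"
      by (intro Bochner_Integration.integral_cong refl) (simp add: power2_eq_square algebra_simps)
    also have "\<dots> = c\<^sup>2 * F - 2 * c * S + G"
      by (simp add: F_def G_def S_def)
    finally show ?thesis .
  qed
  show ?thesis
  proof (cases "F = 0")
    case True
    have "S = 0"
    proof (rule ccontr)
      assume "S \<noteq> 0"
      \<comment> \<open>At this c the quadratic, which is linear when F = 0, takes the value
        -1.\<close>
      then show False using quad[of "(G + 1) / (2 * S)"] True FG by simp
    qed
    then show ?thesis using True by (simp add: F_def S_def)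
  next
    case False
    then have "F > 0" using FG by simp
    then have "S\<^sup>2 \<le> F * G"
      using quad[of "S / F"] by (simp add: field_simps power2_eq_square)
    then show ?thesis by (simp add: F_def G_def S_def)
  qed
qed

text \<open>Replacing the resolvent by its chord over [A, B] gives the mean under the centred law on
  {A, B}, to which \<open>two_point_bound\<close> applies with u = -A and v = B. The case A = B is
  separate because the chord has no slope there.\<close>

lemma expectation_resolvent_exp_le_1:
  assumes l: "0 \<le> l" "l < 1"
    and f: "f \<in> borel_measurable M" "\<And>x. x \<in> space M \<Longrightarrow> f x \<in> {A..B}" and f0: "expectation f = 0"
  defines "K \<equiv> exp (alpha l * (B - A)\<^sup>2 / 8)"
  shows "(1 - l) * expectation (\<lambda>x. exp (f x) / (K - l * exp (f x))) \<le> 1"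
proof -
  have fb: "f \<in> bounded_fun M"
    using f by (intro bounded_funI[of _ _ "max \<bar>A\<bar> \<bar>B\<bar>"]) fastforce+
  note [simp] = integrable_bounded_fun[OF fb]
  have "A \<le> expectation f" "expectation f \<le> B"
    using f(2) by (auto intro!: integral_ge_const integral_le_const AE_I2)
  then have AB: "A \<le> 0" "B \<ge> 0" using f0 by auto
  show ?thesis
  proof (cases "A = B")
    case True
    then have "A = 0" "B = 0" using AB by auto
    then have fx: "f x = 0" if "x \<in> space M" for x using f(2)[OF that] by simp
    have "expectation (\<lambda>x. exp (f x) / (K - l * exp (f x))) = expectation (\<lambda>x. 1 / (K - l))"
      by (intro Bochner_Integration.integral_cong refl) (simp add: fx)
    then show ?thesis using l True by (simp add: K_def prob_space)
  next
    case False
    then have s: "B - A > 0" using AB by simp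
    define \<phi> where "\<phi> x = exp x / (K - l * exp x)" for x
    have lK: "l * exp x < K" if "x \<in> {A..B}" for x
    proof -
      have "l * exp x \<le> l * exp (B - A)" using that AB l by (intro mult_left_mono) auto
      then show ?thesis using mult_exp_less_exp_alpha[OF l, of "B - A"] by (simp add: K_def)
    qed
    have chord: "\<phi> (f x) \<le> (\<phi> B - \<phi> A) / (B - A) * (f x - A) + \<phi> A" if "x \<in> space M" for x
      using convex_on_resolvent_exp[OF l(1) lK] f(2)[OF that] unfolding \<phi>_def
      by (intro convex_onD_Icc'[where f = "\<lambda>x. exp x / (K - l * exp x)"]) auto
    have \<phi>_nonneg: "\<phi> (f x) \<ge> 0" if "x \<in> space M" for x
      using lK[OF f(2)[OF that]] by (simp add: \<phi>_def)
    have lin: "(\<lambda>x. (\<phi> B - \<phi> A) / (B - A) * (f x - A) + \<phi> A) \<in> bounded_fun M"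
      by (intro bounded_fun_intros fb)
    have "expectation (\<lambda>x. \<phi> (f x)) \<le> expectation (\<lambda>x. (\<phi> B - \<phi> A) / (B - A) * (f x - A) + \<phi> A)"
    proof (rule integral_mono[OF _ integrable_bounded_fun[OF lin] chord])
      show "integrable M (\<lambda>x. \<phi> (f x))"
      proof (rule Bochner_Integration.integrable_bound[OF integrable_bounded_fun[OF lin]])
        show "(\<lambda>x. \<phi> (f x)) \<in> borel_measurable M"
          unfolding \<phi>_def using f(1) by measurable
        show "AE x in M. norm (\<phi> (f x)) \<le> norm ((\<phi> B - \<phi> A) / (B - A) * (f x - A) + \<phi> A)"
        proof (rule AE_I2)
          fix x assume "x \<in> space M"
          with chord[of x] \<phi>_nonneg[of x] show "norm (\<phi> (f x)) \<le> norm ((\<phi> B - \<phi> A) / (B - A) * (f x - A) + \<phi> A)"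
            by simp
        qed
      qed
    qed
    also have "\<dots> = (\<phi> B - \<phi> A) / (B - A) * (- A) + \<phi> A"
      by (simp add: f0 prob_space)
    also have "\<dots> = (B * \<phi> A + (-A) * \<phi> B) / (B - A)"
      using s by (simp add: field_simps)
    finally have "(1 - l) * expectation (\<lambda>x. \<phi> (f x)) \<le> (1 - l) * ((B * \<phi> A + (-A) * \<phi> B) / (B - A))"
      using l by (intro mult_left_mono) auto
    also have "\<dots> = (B * ((1 - l) * exp A / (K - l * exp A)) + (-A) * ((1 - l) * exp B / (K - l * exp B))) / (B - A)"
      by (simp add: \<phi>_def right_diff_distrib mult.left_commute[of "1 - l"])
    also have "\<dots> \<le> 1"
      using two_point_bound[OF l, of "-A" B] AB s by (simp add: K_def add.commute)
    finally show ?thesis by (simp add: \<phi>_def)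
  qed
qed

text \<open>A weighted Cauchy-Schwarz inequality with weight D = K - l * exp f: pi (exp f * u)^2 is
  at most pi (exp f * D * u^2) times pi (exp f / D), and the last factor is controlled by the
  resolvent bound.\<close>

lemma exp_tilted_form_bound:
  assumes l: "0 \<le> l" "l < 1"
    and f: "f \<in> borel_measurable M" "\<And>x. x \<in> space M \<Longrightarrow> f x \<in> {A..B}" and f0: "expectation f = 0"
    and u: "u \<in> bounded_fun M"
  shows "l * expectation (\<lambda>x. (exp (f x) * u x)\<^sup>2) + (1 - l) * (expectation (\<lambda>x. exp (f x) * u x))\<^sup>2
    \<le> exp (alpha l * (B - A)\<^sup>2 / 8) * expectation (\<lambda>x. exp (f x) * (u x)\<^sup>2)"
proof -
  define K where "K = exp (alpha l * (B - A)\<^sup>2 / 8)"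
  have fb: "f \<in> bounded_fun M"
    using f by (intro bounded_funI[of _ _ "max \<bar>A\<bar> \<bar>B\<bar>"]) fastforce+
  have "A \<le> expectation f" "expectation f \<le> B"
    using f(2) fb by (auto intro!: integral_ge_const integral_le_const AE_I2 integrable_bounded_fun)
  then have AB: "A \<le> 0" "B \<ge> 0" using f0 by auto
  define \<delta> where "\<delta> = K - l * exp B"
  have "l * exp B \<le> l * exp (B - A)" using AB l by (intro mult_left_mono) auto
  then have \<delta>: "\<delta> > 0" using mult_exp_less_exp_alpha[OF l, of "B - A"] by (simp add: K_def \<delta>_def)
  have w: "K - l * exp (f x) \<ge> \<delta>" if "x \<in> space M" for x
    using f(2)[OF that] l by (auto simp: \<delta>_def intro!: mult_left_mono)
  define S where "S = expectation (\<lambda>x. exp (f x) * u x)"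
  define \<psi> where "\<psi> x = exp (f x) / (K - l * exp (f x))" for x
  define R where "R = expectation \<psi>"
  have R: "(1 - l) * R \<le> 1"
    unfolding R_def \<psi>_def K_def by (rule expectation_resolvent_exp_le_1[OF l f f0])
  \<comment> \<open>Integrating (exp f / D) * (D * u - c)^2 >= 0 gives a bound for every c. The
    optimal c is S / R; this one suffices because (1 - l) * R <= 1, and it avoids dividing by
    R.\<close>
  define c where "c = (1 - l) * S"
  have [simp]: "integrable M (\<lambda>x. exp (f x) * u x)" "integrable M (\<lambda>x. exp (f x) * (u x)\<^sup>2)"
    "integrable M (\<lambda>x. (exp (f x) * u x)\<^sup>2)"
    by (intro integrable_bounded_fun bounded_fun_intros fb u)+
  have inv: "\<psi> \<in> bounded_fun M"
  proof (rule bounded_funI)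
    show "\<psi> \<in> borel_measurable M"
      unfolding \<psi>_def using f(1) by measurable
    fix x assume x: "x \<in> space M"
    show "\<bar>\<psi> x\<bar> \<le> exp B / \<delta>"
      using w[OF x] \<delta> f(2)[OF x] by (auto simp: \<psi>_def abs_divide intro!: frac_le)
  qed
  note [simp] = integrable_bounded_fun[OF inv]
  have "2 * c * S = expectation (\<lambda>x. 2 * c * (exp (f x) * u x))"
    by (simp add: S_def)
  also have "\<dots> \<le> expectation (\<lambda>x. (K * (exp (f x) * (u x)\<^sup>2) - l * (exp (f x) * u x)\<^sup>2)
      + c\<^sup>2 * \<psi> x)"
  proof (rule integral_mono)
    fix x assume x: "x \<in> space M"
    define E where "E = exp (f x)"
    define D where "D = K - l * exp (f x)"
    have D: "D > 0" using w[OF x] \<delta> by (simp add: D_def)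
    have "0 \<le> E / D * (D * u x - c)\<^sup>2" using D by (simp add: E_def)
    also have "\<dots> = E * D * (u x)\<^sup>2 - 2 * c * (E * u x) + c\<^sup>2 * (E / D)"
      using D by (simp add: power2_eq_square field_simps)
    finally show "2 * c * (exp (f x) * u x) \<le> (K * (exp (f x) * (u x)\<^sup>2) - l * (exp (f x) * u x)\<^sup>2)
      + c\<^sup>2 * \<psi> x"
      unfolding \<psi>_def D_def[symmetric] E_def[symmetric]
      by (simp add: D_def E_def[symmetric] power2_eq_square algebra_simps)
  qed (intro integrable_bounded_fun bounded_fun_intros inv fb u)+
  also have "\<dots> = K * expectation (\<lambda>x. exp (f x) * (u x)\<^sup>2) - l * expectation (\<lambda>x. (exp (f x) * u x)\<^sup>2) + c\<^sup>2 * R"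
    by (simp add: R_def)
  finally have "2 * c * S - c\<^sup>2 * R
     \<le> K * expectation (\<lambda>x. exp (f x) * (u x)\<^sup>2) - l * expectation (\<lambda>x. (exp (f x) * u x)\<^sup>2)" by simp
  moreover have "c\<^sup>2 * R \<le> c * S"
  proof -
    have "c\<^sup>2 * R = (1 - l) * S\<^sup>2 * ((1 - l) * R)" by (simp add: c_def power2_eq_square algebra_simps)
    also have "\<dots> \<le> (1 - l) * S\<^sup>2 * 1" using R l by (intro mult_left_mono) auto
    finally show ?thesis by (simp add: c_def power2_eq_square)
  qed
  moreover have "(1 - l) * S\<^sup>2 = c * S" by (simp add: c_def power2_eq_square)
  ultimately show ?thesis by (simp add: S_def K_def)
qed

end

section \<open>Stationary kernels\<close>

lemma bounded_fun_markov_op: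
  assumes P: "P \<in> N \<rightarrow>\<^sub>M prob_algebra M" and h: "h \<in> bounded_fun M"
  shows "markov_op P h \<in> bounded_fun N"
proof -
  obtain C where C: "C \<ge> 0" "\<And>x. x \<in> space M \<Longrightarrow> \<bar>h x\<bar> \<le> C" using bounded_funE[OF h] by blast
  have P': "P \<in> N \<rightarrow>\<^sub>M subprob_algebra M" using P by (rule measurable_prob_algebraD)
  show ?thesis
  proof (rule bounded_funI)
    show "markov_op P h \<in> borel_measurable N"
      unfolding markov_op_def[abs_def] using bounded_fun_measurable[OF h]
      by (intro measurable_compose[OF P' integral_measurable_subprob_algebra])
    fix x assume x: "x \<in> space N"
    interpret Px: prob_space "P x"
      using measurable_space[OF P x] by (simp add: space_prob_algebra)
    have sets: "sets (P x) = sets M"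
      using measurable_space[OF P x] by (simp add: space_prob_algebra)
    then have hP: "h \<in> bounded_fun (P x)" using h bounded_fun_cong_sets by blast
    have "\<bar>markov_op P h x\<bar> \<le> (\<integral>y. \<bar>h y\<bar> \<partial>P x)"
      unfolding markov_op_def by (rule integral_abs_bound)
    also have "\<dots> \<le> C"
      using C(2) sets_eq_imp_space_eq[OF sets] Px.integrable_bounded_fun[OF hP]
      by (intro Px.integral_le_const AE_I2) auto
    finally show "\<bar>markov_op P h x\<bar> \<le> C" .
  qed
qed

locale stationary_kernel = prob_space \<pi> for \<pi> :: "'a measure" +
  fixes P :: "'a \<Rightarrow> 'a measure"
  assumes kernel: "P \<in> \<pi> \<rightarrow>\<^sub>M prob_algebra \<pi>" and invariant: "invariant_measure P \<pi>"
begin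

lemma kernel_subprob: "P \<in> \<pi> \<rightarrow>\<^sub>M subprob_algebra \<pi>"
  using kernel by (rule measurable_prob_algebraD)

lemma prob_space_kernel: "x \<in> space \<pi> \<Longrightarrow> prob_space (P x)"
  and sets_kernel_eq: "x \<in> space \<pi> \<Longrightarrow> sets (P x) = sets \<pi>"
  using measurable_space[OF kernel] by (simp_all add: space_prob_algebra)

lemma bounded_fun_kernel: "x \<in> space \<pi> \<Longrightarrow> h \<in> bounded_fun \<pi> \<Longrightarrow> h \<in> bounded_fun (P x)"
  using bounded_fun_cong_sets[OF sets_kernel_eq] by blast

lemma integrable_kernel: "x \<in> space \<pi> \<Longrightarrow> h \<in> bounded_fun \<pi> \<Longrightarrow> integrable (P x) h"
  by (intro prob_space.integrable_bounded_fun prob_space_kernel bounded_fun_kernel)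

lemma bounded_fun_markov: "h \<in> bounded_fun \<pi> \<Longrightarrow> markov_op P h \<in> bounded_fun \<pi>"
  by (rule bounded_fun_markov_op[OF kernel])

text \<open>Invariance as a fixed point of the Giry bind, the form in which
  \<open>nn_integral_bind\<close> collapses iterated integrals.\<close>

lemma bind_kernel: "\<pi> \<bind> P = \<pi>"
proof (rule measure_eqI)
  show "sets (\<pi> \<bind> P) = sets \<pi>"
    using sets_kernel_eq not_empty by (rule sets_bind)
  then show "emeasure (\<pi> \<bind> P) B = emeasure \<pi> B" if "B \<in> sets (\<pi> \<bind> P)" for B
    using that invariant not_empty kernel_subprob
    by (simp add: emeasure_bind[where N = \<pi>] invariant_measure_def)
qed

lemma nn_integral_kernel:
  "h \<in> borel_measurable \<pi> \<Longrightarrow> (\<integral>\<^sup>+x. \<integral>\<^sup>+y. h y \<partial>P x \<partial>\<pi>) = (\<integral>\<^sup>+x. h x \<partial>\<pi>)"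
  using nn_integral_bind[OF _ kernel_subprob, of h] by (simp add: bind_kernel)

lemma markov_op_const: "x \<in> space \<pi> \<Longrightarrow> markov_op P (\<lambda>_. c) x = c"
  using prob_space_kernel[of x] by (simp add: markov_op_def prob_space.prob_space)

lemma markov_op_diff:
  "x \<in> space \<pi> \<Longrightarrow> f \<in> bounded_fun \<pi> \<Longrightarrow> g \<in> bounded_fun \<pi> \<Longrightarrow>
    markov_op P (\<lambda>y. f y - g y) x = markov_op P f x - markov_op P g x"
  unfolding markov_op_def by (intro Bochner_Integration.integral_diff integrable_kernel)

lemma expectation_markov_op_nonneg:
  assumes h: "h \<in> bounded_fun \<pi>" and pos: "\<And>x. x \<in> space \<pi> \<Longrightarrow> h x \<ge> 0"
  shows "expectation (markov_op P h) = expectation h"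
proof -
  have pos': "AE y in P x. h y \<ge> 0" if "x \<in> space \<pi>" for x
    using pos sets_eq_imp_space_eq[OF sets_kernel_eq[OF that]] by (auto intro!: AE_I2)
  have "ennreal (expectation (markov_op P h)) = (\<integral>\<^sup>+x. ennreal (markov_op P h x) \<partial>\<pi>)"
    using pos' by (intro nn_integral_eq_integral[symmetric] integrable_bounded_fun bounded_fun_markov h AE_I2)
      (auto simp: markov_op_def intro!: integral_nonneg_AE)
  also have "\<dots> = (\<integral>\<^sup>+x. \<integral>\<^sup>+y. ennreal (h y) \<partial>P x \<partial>\<pi>)"
    unfolding markov_op_def using pos' h
    by (intro nn_integral_cong nn_integral_eq_integral[symmetric] integrable_kernel) auto
  also have "\<dots> = (\<integral>\<^sup>+x. ennreal (h x) \<partial>\<pi>)"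
    using bounded_fun_measurable[OF h] by (intro nn_integral_kernel) auto
  also have "\<dots> = ennreal (expectation h)"
    using pos by (intro nn_integral_eq_integral integrable_bounded_fun h AE_I2) auto
  finally show ?thesis
  proof (subst (asm) ennreal_inj)
    show "0 \<le> expectation (markov_op P h)"
      unfolding markov_op_def by (intro Bochner_Integration.integral_nonneg integral_nonneg_AE pos')
    show "0 \<le> expectation h"
      using pos by (rule Bochner_Integration.integral_nonneg)
  qed
qed

lemma expectation_markov_op:
  assumes h: "h \<in> bounded_fun \<pi>"
  shows "expectation (markov_op P h) = expectation h"
proof -
  obtain C where C: "C \<ge> 0" "\<And>x. x \<in> space \<pi> \<Longrightarrow> \<bar>h x\<bar> \<le> C" using bounded_funE[OF h] by blast
  \<comment> \<open>A shift by the bound C makes the function nonnegative, and P fixes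
    constants.\<close>
  have hC: "(\<lambda>x. C - h x) \<in> bounded_fun \<pi>" by (intro bounded_fun_intros h)
  have "C - expectation h = expectation (\<lambda>x. C - h x)"
    by (simp add: integrable_bounded_fun[OF h] prob_space)
  also have "\<dots> = expectation (markov_op P (\<lambda>x. C - h x))"
    using C by (intro expectation_markov_op_nonneg[symmetric] hC) (auto simp: abs_le_iff)
  also have "\<dots> = expectation (\<lambda>x. C - markov_op P h x)"
    by (intro Bochner_Integration.integral_cong refl)
      (simp add: markov_op_diff[OF _ bounded_fun_const h] markov_op_const)
  also have "\<dots> = C - expectation (markov_op P h)"
    by (simp add: integrable_bounded_fun[OF bounded_fun_markov[OF h]] prob_space)
  finally show ?thesis by simp
qed

text \<open>If \<^term>\<open>h\<close> is not integrable with respect to \<^term>\<open>P x\<close>, then \<^term>\<open>markov_op P h x\<close> is \<open>0\<close>,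
  so the pointwise Jensen inequality holds for every \<^term>\<open>x\<close>.\<close>

lemma markov_op_contraction:
  assumes h: "h \<in> L2_space \<pi>"
  shows "expectation (\<lambda>x. (markov_op P h x)\<^sup>2) \<le> expectation (\<lambda>x. (h x)\<^sup>2)"
proof -
  have hm [measurable]: "h \<in> borel_measurable \<pi>" and h2: "integrable \<pi> (\<lambda>x. (h x)\<^sup>2)"
    using h by (auto simp: L2_space_def)
  have pointwise: "ennreal ((markov_op P h x)\<^sup>2) \<le> (\<integral>\<^sup>+y. ennreal ((h y)\<^sup>2) \<partial>P x)" if x: "x \<in> space \<pi>" for x
  proof (cases "integrable (P x) (\<lambda>y. (h y)\<^sup>2)")
    case True
    interpret Px: prob_space "P x" by (rule prob_space_kernel[OF x])
    have "h \<in> borel_measurable (P x)"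
      using hm measurable_cong_sets[OF sets_kernel_eq[OF x] refl] by blast
    then have "integrable (P x) h"
      using True by (rule Px.square_integrable_imp_integrable)
    then have "(markov_op P h x)\<^sup>2 \<le> (\<integral>y. (h y)\<^sup>2 \<partial>P x)"
      using Px.variance_eq[of h] Px.variance_positive[of h] True by (simp add: markov_op_def)
    then show ?thesis
      using True by (subst nn_integral_eq_integral) (auto intro!: ennreal_leI)
  next
    case False
    have "(\<lambda>y. (h y)\<^sup>2) \<in> borel_measurable (P x)"
      using hm measurable_cong_sets[OF sets_kernel_eq[OF x] refl] by (metis borel_measurable_power)
    then have "(\<integral>\<^sup>+y. ennreal ((h y)\<^sup>2) \<partial>P x) = \<infinity>"
      using False by (simp add: integrable_iff_bounded) (metis top.not_eq_extremum)
    then show ?thesis by simp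
  qed
  have "(\<integral>\<^sup>+x. ennreal ((markov_op P h x)\<^sup>2) \<partial>\<pi>) \<le> (\<integral>\<^sup>+x. \<integral>\<^sup>+y. ennreal ((h y)\<^sup>2) \<partial>P x \<partial>\<pi>)"
    by (intro nn_integral_mono pointwise)
  also have "\<dots> = ennreal (expectation (\<lambda>x. (h x)\<^sup>2))"
    using h2 by (simp add: nn_integral_kernel nn_integral_eq_integral)
  finally show ?thesis
    by (intro integral_real_bounded) auto
qed

text \<open>A real supremum bounds its elements only when the set is bounded above; the contraction
  property supplies the bound 1.\<close>

lemma bdd_above_spectral:
  "bdd_above (insert 0 {L2_norm \<pi> (markov_op P h) | h.
     h \<in> L2_space \<pi> \<and> L2_norm \<pi> h = 1 \<and> expectation h = 0})"
proof (rule bdd_aboveI[of _ 1])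
  fix r assume "r \<in> insert 0 {L2_norm \<pi> (markov_op P h) | h.
     h \<in> L2_space \<pi> \<and> L2_norm \<pi> h = 1 \<and> expectation h = 0}"
  then consider "r = 0" | h where "r = L2_norm \<pi> (markov_op P h)" "h \<in> L2_space \<pi>" "L2_norm \<pi> h = 1"
    by auto
  then show "r \<le> 1"
  proof cases
    case 2
    then show ?thesis
      using markov_op_contraction[of h] by (metis L2_norm_def real_sqrt_le_mono)
  qed simp
qed

lemma spectral_lambda_nonneg: "spectral_lambda \<pi> P \<ge> 0"
  unfolding spectral_lambda_def by (rule cSup_upper[OF _ bdd_above_spectral]) simp

lemma bounded_fun_L2: "h \<in> bounded_fun \<pi> \<Longrightarrow> h \<in> L2_space \<pi>"
  by (simp add: L2_space_def bounded_fun_measurable integrable_bounded_fun bounded_fun_power)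

lemma markov_op_spectral_bound:
  assumes h: "h \<in> bounded_fun \<pi>" and h0: "expectation h = 0"
  shows "expectation (\<lambda>x. (markov_op P h x)\<^sup>2) \<le> (spectral_lambda \<pi> P)\<^sup>2 * expectation (\<lambda>x. (h x)\<^sup>2)"
\<comment> \<open>A function of norm 0 cannot be normalised; for it the contraction property already
  makes the left side vanish.\<close>
proof (cases "expectation (\<lambda>x. (h x)\<^sup>2) = 0")
  case True
  then show ?thesis using markov_op_contraction[OF bounded_fun_L2[OF h]] by simp
next
  case False
  define H where "H = expectation (\<lambda>x. (h x)\<^sup>2)"
  have H: "H > 0" using False unfolding H_def by (simp add: less_le)
  define c where "c = 1 / sqrt H"
  have c2: "c\<^sup>2 = 1 / H" using H by (simp add: c_def power_divide)
  have ch: "(\<lambda>x. c * h x) \<in> bounded_fun \<pi>" by (rule bounded_fun_cmult[OF h])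
  have "L2_norm \<pi> (markov_op P (\<lambda>x. c * h x)) \<le> spectral_lambda \<pi> P"
    unfolding spectral_lambda_def
  proof (rule cSup_upper[OF _ bdd_above_spectral])
    have "L2_norm \<pi> (\<lambda>x. c * h x) = 1"
      using H by (simp add: L2_norm_def power_mult_distrib c2 flip: H_def)
    then show "L2_norm \<pi> (markov_op P (\<lambda>x. c * h x)) \<in> insert 0 {L2_norm \<pi> (markov_op P h) | h.
        h \<in> L2_space \<pi> \<and> L2_norm \<pi> h = 1 \<and> expectation h = 0}"
      using bounded_fun_L2[OF ch] h0 by auto
  qed
  then have "(L2_norm \<pi> (markov_op P (\<lambda>x. c * h x)))\<^sup>2 \<le> (spectral_lambda \<pi> P)\<^sup>2"
    by (intro power_mono) (auto simp: L2_norm_def)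
  also have "(L2_norm \<pi> (markov_op P (\<lambda>x. c * h x)))\<^sup>2 = c\<^sup>2 * expectation (\<lambda>x. (markov_op P h x)\<^sup>2)"
    by (simp add: L2_norm_def markov_op_def power_mult_distrib)
  finally show ?thesis
    using H by (simp add: c2 H_def[symmetric] field_simps)
qed

text \<open>The quadratic form of the Leon--Perron operator \<open>\<lambda> I + (1 - \<lambda>) \<pi>\<close>.\<close>

definition lp_form :: "('a \<Rightarrow> real) \<Rightarrow> real" where
  "lp_form h = spectral_lambda \<pi> P * expectation (\<lambda>x. (h x)\<^sup>2) + (1 - spectral_lambda \<pi> P) * (expectation h)\<^sup>2"

text \<open>Splits the form into its part on constants, where P acts as the identity, and its part
  on mean-zero functions, where P contracts by lambda.\<close>

lemma lp_form_centered:
  assumes h: "h \<in> bounded_fun \<pi>"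
  shows "lp_form h = (expectation h)\<^sup>2 + spectral_lambda \<pi> P * expectation (\<lambda>x. (h x - expectation h)\<^sup>2)"
proof -
  have "expectation (\<lambda>x. (h x - expectation h)\<^sup>2) = expectation (\<lambda>x. (h x)\<^sup>2) - (expectation h)\<^sup>2"
    by (intro variance_eq integrable_bounded_fun bounded_fun_power h)
  then show ?thesis by (simp only: lp_form_def) (simp add: algebra_simps)
qed

lemma expectation_sq_le_lp_form: "h \<in> bounded_fun \<pi> \<Longrightarrow> (expectation h)\<^sup>2 \<le> lp_form h"
  using spectral_lambda_nonneg by (simp add: lp_form_centered)

text \<open>With h = a + h0 and v = b + v0, the cross terms vanish: P fixes constants, and
  invariance gives P v0 mean zero. What remains is a * b + s with s^2 <= l^2 * H * V, and
  Cauchy-Schwarz for the vectors (a, sqrt (l * H)) and (b, sqrt (l * V)) finishes. Self-adjointness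
  of P never enters.\<close>

lemma markov_op_lp_form:
  assumes h: "h \<in> bounded_fun \<pi>" and v: "v \<in> bounded_fun \<pi>"
  shows "(expectation (\<lambda>x. h x * markov_op P v x))\<^sup>2 \<le> lp_form h * lp_form v"
proof -
  define l where "l = spectral_lambda \<pi> P"
  define a where "a = expectation h"
  define b where "b = expectation v"
  define h0 where "h0 x = h x - a" for x
  define v0 where "v0 x = v x - b" for x
  define H where "H = expectation (\<lambda>x. (h0 x)\<^sup>2)"
  define V where "V = expectation (\<lambda>x. (v0 x)\<^sup>2)"
  define s where "s = expectation (\<lambda>x. h0 x * markov_op P v0 x)"
  have l: "l \<ge> 0" using spectral_lambda_nonneg by (simp add: l_def)
  have HV: "H \<ge> 0" "V \<ge> 0" by (simp_all add: H_def V_def)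
  have h0: "h0 \<in> bounded_fun \<pi>" and v0: "v0 \<in> bounded_fun \<pi>"
    unfolding h0_def v0_def by (intro bounded_fun_intros h v)+
  note Pv0 = bounded_fun_markov[OF v0]
  have v0_mean: "expectation v0 = 0"
    unfolding v0_def by (simp add: integrable_bounded_fun[OF v] prob_space b_def)
  have "expectation (\<lambda>x. h x * markov_op P v x)
      = expectation (\<lambda>x. b * h x + (a * markov_op P v0 x + h0 x * markov_op P v0 x))"
  proof (intro Bochner_Integration.integral_cong refl)
    fix x assume x: "x \<in> space \<pi>"
    have "markov_op P v0 x = markov_op P v x - b"
      unfolding v0_def using markov_op_diff[OF x v bounded_fun_const[of b]] by (simp add: markov_op_const[OF x])
    then have "markov_op P v x = markov_op P v0 x + b" by simp
    then show "h x * markov_op P v x = b * h x + (a * markov_op P v0 x + h0 x * markov_op P v0 x)"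
      by (simp only: h0_def) (simp add: algebra_simps)
  qed
  also have "\<dots> = b * a + (a * expectation (markov_op P v0) + s)"
    by (simp add: s_def a_def integrable_bounded_fun h bounded_fun_mult[OF h0 Pv0] Pv0)
  also have "\<dots> = a * b + s" by (simp add: expectation_markov_op[OF v0] v0_mean)
  finally have eq: "expectation (\<lambda>x. h x * markov_op P v x) = a * b + s" .
  have "s\<^sup>2 \<le> H * expectation (\<lambda>x. (markov_op P v0 x)\<^sup>2)"
    unfolding s_def H_def by (rule Cauchy_Schwarz_bounded_fun[OF h0 Pv0])
  also have "\<dots> \<le> H * (l\<^sup>2 * V)"
    unfolding l_def V_def using HV by (intro mult_left_mono markov_op_spectral_bound v0 v0_mean)
  finally have s: "s\<^sup>2 \<le> l\<^sup>2 * H * V" by (simp add: algebra_simps)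
  \<comment> \<open>The arithmetic-geometric mean inequality in squared form, so that no square
    roots of H and V are needed.\<close>
  have "(2 * (a * b * s))\<^sup>2 = 4 * (a * b)\<^sup>2 * s\<^sup>2" by (simp add: power_mult_distrib)
  also have "\<dots> \<le> 4 * (a * b)\<^sup>2 * (l\<^sup>2 * H * V)" by (intro mult_left_mono s) simp
  also have "\<dots> = (l * (a\<^sup>2 * V + b\<^sup>2 * H))\<^sup>2 - l\<^sup>2 * (a\<^sup>2 * V - b\<^sup>2 * H)\<^sup>2"
    by (simp add: power2_eq_square algebra_simps)
  also have "\<dots> \<le> (l * (a\<^sup>2 * V + b\<^sup>2 * H))\<^sup>2" by simp
  finally have "2 * (a * b * s) \<le> l * (a\<^sup>2 * V + b\<^sup>2 * H)"
    by (rule power2_le_imp_le) (use l HV in simp)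
  then have "(a * b + s)\<^sup>2 \<le> (a\<^sup>2 + l * H) * (b\<^sup>2 + l * V)"
    using s by (simp add: power2_eq_square algebra_simps)
  then show ?thesis
    unfolding eq by (simp add: lp_form_centered[OF h] lp_form_centered[OF v] l_def a_def b_def H_def V_def h0_def v0_def)
qed

end

section \<open>Exponential functionals\<close>

text \<open>\<open>fk P g m k x\<close> is \<open>E [exp (\<Sum>i\<in>{k..<k+m}. g i (X i)) | X k = x]\<close>.\<close>

fun fk :: "('a \<Rightarrow> 'a measure) \<Rightarrow> (nat \<Rightarrow> 'a \<Rightarrow> real) \<Rightarrow> nat \<Rightarrow> nat \<Rightarrow> 'a \<Rightarrow> real" where
  "fk P g 0 k = (\<lambda>x. 1)"
| "fk P g (Suc m) k = (\<lambda>x. exp (g k x) * markov_op P (fk P g m (Suc k)) x)"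

lemma bounded_fun_fk:
  assumes P: "P \<in> M \<rightarrow>\<^sub>M prob_algebra M"
  shows "(\<And>i. i \<in> {k..<k + m} \<Longrightarrow> g i \<in> bounded_fun M) \<Longrightarrow> fk P g m k \<in> bounded_fun M"
proof (induction m arbitrary: k)
  case (Suc m)
  have "fk P g m (Suc k) \<in> bounded_fun M" by (rule Suc.IH) (simp add: Suc.prems)
  moreover have "g k \<in> bounded_fun M" by (rule Suc.prems) simp
  ultimately show ?case by (auto intro: bounded_fun_intros bounded_fun_markov_op[OF P])
qed (simp add: bounded_fun_const)

text \<open>Strict positivity is wanted because Jensen's inequality for \<open>powr\<close> is
  applied on the open half-line.\<close>

lemma fk_pos:
  assumes P: "P \<in> M \<rightarrow>\<^sub>M prob_algebra M"
  shows "(\<And>i. i \<in> {k..<k + m} \<Longrightarrow> g i \<in> bounded_fun M) \<Longrightarrow> x \<in> space M \<Longrightarrow> fk P g m k x > 0"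
proof (induction m arbitrary: k x)
  case (Suc m)
  interpret Px: prob_space "P x"
    using measurable_space[OF P Suc.prems(2)] by (simp add: space_prob_algebra)
  have sets: "sets (P x) = sets M"
    using measurable_space[OF P Suc.prems(2)] by (simp add: space_prob_algebra)
  have IH: "fk P g m (Suc k) y > 0" if "y \<in> space M" for y
    by (rule Suc.IH) (simp_all add: Suc.prems that)
  have "fk P g m (Suc k) \<in> bounded_fun M"
    by (rule bounded_fun_fk[OF P]) (simp add: Suc.prems)
  then have "fk P g m (Suc k) \<in> bounded_fun (P x)"
    using bounded_fun_cong_sets[OF sets] by blast
  then have "0 < markov_op P (fk P g m (Suc k)) x"
    unfolding markov_op_def using IH sets_eq_imp_space_eq[OF sets]
    by (intro Px.expectation_greater Px.integrable_bounded_fun AE_I2) simp_all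
  then show ?case by simp
qed simp

context stationary_kernel
begin

text \<open>Jensen's inequality under each \<open>P x\<close> gives (P v)^q <= P (v^q), and exp
  (g)^q = exp (q * g). The q-th moment left over by Hoelder's inequality thus becomes a first moment
  of the same kind, for the functions q * g.\<close>

lemma fk_powr_le:
  assumes q: "q \<ge> 1"
  shows "(\<And>i. i \<in> {k..<k + m} \<Longrightarrow> g i \<in> bounded_fun \<pi>) \<Longrightarrow> x \<in> space \<pi> \<Longrightarrow>
    fk P g m k x powr q \<le> fk P (\<lambda>i y. q * g i y) m k x"
proof (induction m arbitrary: k x)
  case (Suc m)
  interpret Px: prob_space "P x" by (rule prob_space_kernel[OF Suc.prems(2)])
  note space = sets_eq_imp_space_eq[OF sets_kernel_eq[OF Suc.prems(2)]]
  let ?v = "fk P g m (Suc k)" and ?w = "fk P (\<lambda>i y. q * g i y) m (Suc k)"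
  have v: "?v \<in> bounded_fun \<pi>" by (rule bounded_fun_fk[OF kernel]) (simp add: Suc.prems)
  have w: "?w \<in> bounded_fun \<pi>" by (rule bounded_fun_fk[OF kernel]) (simp add: Suc.prems bounded_fun_cmult)
  have v_pos: "?v y > 0" if "y \<in> space \<pi>" for y
    by (rule fk_pos[OF kernel]) (simp_all add: Suc.prems that)
  have IH: "?v y powr q \<le> ?w y" if "y \<in> space \<pi>" for y
    by (rule Suc.IH) (simp_all add: Suc.prems that)
  have int: "integrable (P x) (\<lambda>y. ?v y powr q)"
  proof (rule Bochner_Integration.integrable_bound[OF integrable_kernel[OF Suc.prems(2) w]])
    show "(\<lambda>y. ?v y powr q) \<in> borel_measurable (P x)"
      using bounded_fun_measurable[OF bounded_fun_kernel[OF Suc.prems(2) v]] by measurable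
    show "AE y in P x. norm (?v y powr q) \<le> norm (?w y)"
      using IH space by (intro AE_I2) fastforce
  qed
  have "(markov_op P ?v x) powr q \<le> (\<integral>y. ?v y powr q \<partial>P x)"
    unfolding markov_op_def
    using v_pos space int powr_convex[OF q]
    by (intro Px.jensens_inequality[where I = "{0<..}" and a = 0] integrable_kernel[OF Suc.prems(2) v] AE_I2) auto
  also have "\<dots> \<le> markov_op P ?w x"
    unfolding markov_op_def using IH space
    by (intro integral_mono[OF int integrable_kernel[OF Suc.prems(2) w]]) auto
  finally have "exp (g k x) powr q * (markov_op P ?v x) powr q \<le> exp (q * g k x) * markov_op P ?w x"
    by (simp add: exp_powr_real mult.commute)
  moreover have "markov_op P ?v x \<ge> 0"
    unfolding markov_op_def using v_pos space by (intro Bochner_Integration.integral_nonneg) (auto intro: less_imp_le)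
  ultimately show ?case by (simp add: powr_mult)
qed simp

text \<open>Each step contributes K^2, as the form is quadratic: the tilted bound is squared, and
  one factor \<open>lp_form ?v\<close> cancels. If that factor is 0, the step holds because the
  right side is nonnegative. The induction starts from the constant 1, whose form is l + (1 - l) =
  1.\<close>

lemma lp_form_fk_le:
  assumes l1: "spectral_lambda \<pi> P < 1"
  shows "(\<And>i. i \<in> {k..<k + m} \<Longrightarrow> g i \<in> borel_measurable \<pi>) \<Longrightarrow>
    (\<And>i x. i \<in> {k..<k + m} \<Longrightarrow> x \<in> space \<pi> \<Longrightarrow> g i x \<in> {A i..B i}) \<Longrightarrow>
    (\<And>i. i \<in> {k..<k + m} \<Longrightarrow> expectation (g i) = 0) \<Longrightarrow>
    lp_form (fk P g m k) \<le> (exp (alpha (spectral_lambda \<pi> P) * (\<Sum>i\<in>{k..<k + m}. (B i - A i)\<^sup>2 / 8)))\<^sup>2"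
proof (induction m arbitrary: k)
  case 0
  then show ?case by (simp add: lp_form_def prob_space)
next
  case (Suc m)
  define l where "l = spectral_lambda \<pi> P"
  have l: "0 \<le> l" "l < 1" using l1 spectral_lambda_nonneg by (auto simp: l_def)
  define K where "K = exp (alpha l * ((B k - A k)\<^sup>2 / 8))"
  have gb: "g i \<in> bounded_fun \<pi>" if "i \<in> {k..<k + Suc m}" for i
    using Suc.prems(1,2)[OF that] by (intro bounded_funI[of _ _ "max \<bar>A i\<bar> \<bar>B i\<bar>"]) fastforce+
  let ?v = "fk P g (Suc m) k" and ?v' = "fk P g m (Suc k)"
  have v: "?v \<in> bounded_fun \<pi>" by (rule bounded_fun_fk[OF kernel gb])
  have v': "?v' \<in> bounded_fun \<pi>" by (rule bounded_fun_fk[OF kernel]) (simp add: gb)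
  have nonneg: "lp_form h \<ge> 0" if "h \<in> bounded_fun \<pi>" for h
    using expectation_sq_le_lp_form[OF that] zero_le_power2 by (rule order_trans[rotated])
  have "lp_form ?v \<le> K * expectation (\<lambda>x. exp (g k x) * (markov_op P ?v' x)\<^sup>2)"
    using exp_tilted_form_bound[OF l, of "g k" "A k" "B k" "markov_op P ?v'"] Suc.prems bounded_fun_markov[OF v']
    by (simp add: lp_form_def K_def flip: l_def)
  also have "(\<lambda>x. exp (g k x) * (markov_op P ?v' x)\<^sup>2) = (\<lambda>x. ?v x * markov_op P ?v' x)"
    by (simp add: power2_eq_square mult.assoc)
  finally have "lp_form ?v \<le> K * expectation (\<lambda>x. ?v x * markov_op P ?v' x)" .
  then have "(lp_form ?v)\<^sup>2 \<le> (K * expectation (\<lambda>x. ?v x * markov_op P ?v' x))\<^sup>2"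
    by (intro power_mono nonneg v)
  also have "\<dots> = K\<^sup>2 * (expectation (\<lambda>x. ?v x * markov_op P ?v' x))\<^sup>2"
    by (simp only: power_mult_distrib)
  also have "\<dots> \<le> K\<^sup>2 * (lp_form ?v * lp_form ?v')"
    by (intro mult_left_mono markov_op_lp_form v v') simp
  finally have "lp_form ?v * lp_form ?v \<le> lp_form ?v * (K\<^sup>2 * lp_form ?v')"
    by (simp add: power2_eq_square mult_ac)
  then have "lp_form ?v \<le> K\<^sup>2 * lp_form ?v'"
    using nonneg[OF v] nonneg[OF v'] by (cases "lp_form ?v = 0") (auto simp: mult_le_cancel_left_pos)
  also have "\<dots> \<le> K\<^sup>2 * (exp (alpha l * (\<Sum>i\<in>{Suc k..<Suc k + m}. (B i - A i)\<^sup>2 / 8)))\<^sup>2"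
    unfolding l_def by (intro mult_left_mono Suc.IH Suc.prems) auto
  also have "\<dots> = (exp (alpha l * (\<Sum>i\<in>{k..<k + Suc m}. (B i - A i)\<^sup>2 / 8)))\<^sup>2"
    by (simp add: K_def sum.atLeast_Suc_lessThan[of k] distrib_left exp_add power_mult_distrib)
  finally show ?case by (simp only: l_def)
qed

lemma expectation_fk_le:
  assumes "spectral_lambda \<pi> P < 1"
    and g: "\<And>i. i \<in> {k..<k + m} \<Longrightarrow> g i \<in> borel_measurable \<pi>"
      "\<And>i x. i \<in> {k..<k + m} \<Longrightarrow> x \<in> space \<pi> \<Longrightarrow> g i x \<in> {A i..B i}"
      "\<And>i. i \<in> {k..<k + m} \<Longrightarrow> expectation (g i) = 0"
  shows "expectation (fk P g m k) \<le> exp (alpha (spectral_lambda \<pi> P) * (\<Sum>i\<in>{k..<k + m}. (B i - A i)\<^sup>2 / 8))"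
proof (rule power2_le_imp_le)
  have "g i \<in> bounded_fun \<pi>" if "i \<in> {k..<k + m}" for i
    using g(1,2)[OF that] by (intro bounded_funI[of _ _ "max \<bar>A i\<bar> \<bar>B i\<bar>"]) fastforce+
  then have "(expectation (fk P g m k))\<^sup>2 \<le> lp_form (fk P g m k)"
    by (intro expectation_sq_le_lp_form bounded_fun_fk[OF kernel])
  also have "\<dots> \<le> (exp (alpha (spectral_lambda \<pi> P) * (\<Sum>i\<in>{k..<k + m}. (B i - A i)\<^sup>2 / 8)))\<^sup>2"
    using assms by (rule lp_form_fk_le)
  finally show "(expectation (fk P g m k))\<^sup>2 \<le> \<dots>" .
qed simp

end

section \<open>Change of the initial law and the Markov property\<close>

text \<open>Young's inequality applied to f / A and g / B, where A and B are the two norms. A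
  vanishing norm excludes this normalisation, but then the product is 0 almost everywhere.\<close>

lemma Hoelder_nn_integral:
  fixes f g :: "'a \<Rightarrow> real"
  assumes pq: "p > 1" "q > 1" "1 / p + 1 / q = 1"
    and [measurable]: "f \<in> borel_measurable M" "g \<in> borel_measurable M"
    and nonneg: "\<And>x. x \<in> space M \<Longrightarrow> f x \<ge> 0" "\<And>x. x \<in> space M \<Longrightarrow> g x \<ge> 0"
    and I: "(\<integral>\<^sup>+x. ennreal (f x powr p) \<partial>M) = ennreal I" "I \<ge> 0"
    and J: "(\<integral>\<^sup>+x. ennreal (g x powr q) \<partial>M) = ennreal J" "J \<ge> 0"
  shows "(\<integral>\<^sup>+x. ennreal (f x * g x) \<partial>M) \<le> ennreal (I powr (1 / p) * J powr (1 / q))"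
proof (cases "I = 0 \<or> J = 0")
  case True
  have "AE x in M. f x * g x = 0"
  proof (cases "I = 0")
    case True
    then have "AE x in M. ennreal (f x powr p) = 0"
      using I nn_integral_0_iff_AE[of "\<lambda>x. ennreal (f x powr p)" M] by simp
    then show ?thesis by eventually_elim (auto simp: ennreal_eq_0_iff)
  next
    case False
    then have "J = 0" using True by simp
    then have "AE x in M. ennreal (g x powr q) = 0"
      using J nn_integral_0_iff_AE[of "\<lambda>x. ennreal (g x powr q)" M] by simp
    then show ?thesis by eventually_elim (auto simp: ennreal_eq_0_iff)
  qed
  then have "(\<integral>\<^sup>+x. ennreal (f x * g x) \<partial>M) = (\<integral>\<^sup>+x. 0 \<partial>M)"
    by (intro nn_integral_cong_AE) (auto elim: eventually_mono)
  then show ?thesis by simp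
next
  case False
  then have IJ: "I > 0" "J > 0" using I(2) J(2) by auto
  define A where "A = I powr (1 / p)"
  define B where "B = J powr (1 / q)"
  have AB: "A > 0" "B > 0" using IJ by (simp_all add: A_def B_def)
  have Ap: "A powr p = I" and Bq: "B powr q = J"
    using pq IJ by (simp_all add: A_def B_def powr_powr)
  have "(\<integral>\<^sup>+x. ennreal (f x * g x) \<partial>M)
      \<le> (\<integral>\<^sup>+x. ennreal (A * B / (p * I)) * ennreal (f x powr p) + ennreal (A * B / (q * J)) * ennreal (g x powr q) \<partial>M)"
  proof (rule nn_integral_mono)
    fix x assume x: "x \<in> space M"
    have "(f x / A) * (g x / B) \<le> (f x / A) powr p / p + (g x / B) powr q / q"
      using pq nonneg[OF x] AB by (intro Youngs_inequality) auto
    also have "\<dots> = f x powr p / (p * I) + g x powr q / (q * J)"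
      using nonneg[OF x] AB by (simp add: powr_divide Ap Bq mult.commute)
    finally have "A * B * ((f x / A) * (g x / B)) \<le> A * B * (f x powr p / (p * I) + g x powr q / (q * J))"
      using AB by (intro mult_left_mono) auto
    then have "f x * g x \<le> A * B / (p * I) * f x powr p + A * B / (q * J) * g x powr q"
      using AB by (simp add: algebra_simps)
    then show "ennreal (f x * g x) \<le> ennreal (A * B / (p * I)) * ennreal (f x powr p)
        + ennreal (A * B / (q * J)) * ennreal (g x powr q)"
      using AB pq IJ by (simp add: ennreal_leI flip: ennreal_mult ennreal_plus)
  qed
  also have "\<dots> = ennreal (A * B / (p * I)) * ennreal I + ennreal (A * B / (q * J)) * ennreal J"
    by (simp add: nn_integral_add nn_integral_cmult I J)
  also have "\<dots> = ennreal (A * B / (p * I) * I + A * B / (q * J) * J)"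
    using AB pq IJ by (simp flip: ennreal_mult ennreal_plus)
  also have "A * B / (p * I) * I + A * B / (q * J) * J = A * B * (1 / p + 1 / q)"
    using IJ by (simp add: field_simps)
  finally show ?thesis by (simp add: pq A_def B_def)
qed

text \<open>Change of measure: the integral of v against \<open>\<nu>\<close> is that of density
  times v, to which Hoelder's inequality applies. For p = \<infinity> the essential supremum bounds
  the density directly and q = 1.\<close>

lemma (in prob_space) integral_le_density_norm:
  assumes ac: "absolutely_continuous M \<nu>" and sets: "sets \<nu> = sets M" and \<nu>: "finite_measure \<nu>"
    and p: "1 < p" "density_norm M \<nu> p < \<infinity>"
    and v: "v \<in> bounded_fun M" "\<And>x. x \<in> space M \<Longrightarrow> v x \<ge> 0"
  defines "q \<equiv> conjugate_exponent p"
  shows "(\<integral>x. v x \<partial>\<nu>) \<le> enn2real (density_norm M \<nu> p) * (expectation (\<lambda>x. v x powr q)) powr (1 / q)"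
proof -
  interpret \<nu>: finite_measure \<nu> by fact
  define \<rho> where "\<rho> x = enn2real (RN_deriv M \<nu> x)" for x
  define N where "N = enn2real (density_norm M \<nu> p)"
  note [measurable] = bounded_fun_measurable[OF v(1)]
  have \<rho>m [measurable]: "\<rho> \<in> borel_measurable M" by (simp add: \<rho>_def[abs_def])
  have \<rho>_nonneg: "\<rho> x \<ge> 0" for x by (simp add: \<rho>_def)
  have N: "density_norm M \<nu> p = ennreal N" using p(2) by (simp add: N_def)
  \<comment> \<open>\<open>enn2real\<close> sends \<infinity> to 0, so replacing the derivative by
    its real version is harmless only where it is finite.\<close>
  have fin: "AE x in M. RN_deriv M \<nu> x \<noteq> \<infinity>"
    using RN_deriv_finite[OF \<nu>.sigma_finite_measure_axioms ac sets] .
  have vq: "(\<lambda>x. v x powr q) \<in> bounded_fun M" if "q \<ge> 1"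
  proof -
    obtain C where "C \<ge> 0" "\<And>x. x \<in> space M \<Longrightarrow> \<bar>v x\<bar> \<le> C" using bounded_funE[OF v(1)] by blast
    then show ?thesis
      using v(2) that by (intro bounded_funI[of _ _ "C powr q"]) (auto intro!: powr_mono2)
  qed
  have "(\<integral>x. v x \<partial>\<nu>) \<le> N * (expectation (\<lambda>x. v x powr q)) powr (1 / q)"
  proof (rule integral_real_bounded)
    show "0 \<le> N * (expectation (\<lambda>x. v x powr q)) powr (1 / q)" by (simp add: N_def)
    have "(\<integral>\<^sup>+x. ennreal (v x) \<partial>\<nu>) = (\<integral>\<^sup>+x. RN_deriv M \<nu> x * ennreal (v x) \<partial>M)"
      by (intro RN_deriv_nn_integral ac sets) measurable
    also have "\<dots> = (\<integral>\<^sup>+x. ennreal (\<rho> x * v x) \<partial>M)"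
    proof (rule nn_integral_cong_AE)
      show "AE x in M. RN_deriv M \<nu> x * ennreal (v x) = ennreal (\<rho> x * v x)"
        using fin AE_space
      proof eventually_elim
        case (elim x)
        then have "RN_deriv M \<nu> x = ennreal (\<rho> x)" by (simp add: \<rho>_def less_top)
        then show ?case using elim v(2) \<rho>_nonneg by (simp add: ennreal_mult)
      qed
    qed
    also have "\<dots> \<le> ennreal (N * (expectation (\<lambda>x. v x powr q)) powr (1 / q))"
    proof (cases "p = \<infinity>")
      case True
      then have q: "q = 1" by (simp add: q_def conjugate_exponent_def)
      have "esssup M (\<lambda>x. ennreal \<bar>\<rho> x\<bar>) = ennreal N"
        using N True by (simp add: density_norm_def Lp_norm_def \<rho>_def)
      then have "AE x in M. ennreal \<bar>\<rho> x\<bar> \<le> ennreal N"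
        using esssup_AE[of "\<lambda>x. ennreal \<bar>\<rho> x\<bar>" M] by simp
      then have "AE x in M. \<rho> x \<le> N" by eventually_elim (simp add: N_def)
      then have "(\<integral>\<^sup>+x. ennreal (\<rho> x * v x) \<partial>M) \<le> (\<integral>\<^sup>+x. ennreal (N * v x) \<partial>M)"
        using AE_space
        by (intro nn_integral_mono_AE, eventually_elim) (auto intro!: ennreal_leI mult_right_mono v)
      also have "\<dots> = ennreal (expectation (\<lambda>x. N * v x))"
        using v by (intro nn_integral_eq_integral integrable_bounded_fun bounded_fun_cmult AE_I2) (auto simp: N_def)
      also have "expectation (\<lambda>x. N * v x) = N * expectation (\<lambda>x. v x powr q)"
        using v(2) by (simp add: q cong: Bochner_Integration.integral_cong)
      also have "expectation (\<lambda>x. v x powr q) = expectation (\<lambda>x. v x powr q) powr (1 / q)"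
        by (simp add: q Bochner_Integration.integral_nonneg)
      finally show ?thesis .
    next
      case False
      define r where "r = enn2real p"
      have pr: "p = ennreal r" using False by (simp add: r_def less_top)
      have r: "r > 1" using p(1) unfolding pr by (metis ennreal_1 ennreal_less_iff zero_le_one)
      have q: "q = r / (r - 1)" using False by (simp add: q_def conjugate_exponent_def r_def)
      have q1: "q > 1" and rq: "1 / r + 1 / q = 1" using r by (simp_all add: q field_simps)
      define I where "I = (\<integral>\<^sup>+x. ennreal (\<rho> x powr r) \<partial>M)"
      have dn: "density_norm M \<nu> p = (if I = \<infinity> then \<infinity> else ennreal (enn2real I powr (1 / r)))"
        using False \<rho>_nonneg by (simp add: density_norm_def Lp_norm_def I_def Let_def flip: \<rho>_def r_def)
      then have I_fin: "I \<noteq> \<infinity>" using p(2) by auto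
      have N_eq: "N = enn2real I powr (1 / r)" using dn I_fin by (simp add: N_def)
      have J: "(\<integral>\<^sup>+x. ennreal (v x powr q) \<partial>M) = ennreal (expectation (\<lambda>x. v x powr q))"
        using q1 by (intro nn_integral_eq_integral integrable_bounded_fun vq) auto
      show ?thesis
        unfolding N_eq using I_fin
        by (intro Hoelder_nn_integral r q1 rq J \<rho>m v(2) \<rho>_nonneg)
          (auto simp: less_top simp flip: I_def intro!: Bochner_Integration.integral_nonneg)
    qed
    finally show "(\<integral>\<^sup>+x. ennreal (v x) \<partial>\<nu>) \<le> ennreal (N * (expectation (\<lambda>x. v x powr q)) powr (1 / q))" .
  qed
  then show ?thesis by (simp add: N_def)
qed

section \<open>The natural filtration and the Markov property\<close>

lemma space_natural_filtration: "space (natural_filtration \<Omega> M X n) = space \<Omega>"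
  unfolding natural_filtration_def by (rule space_measure_of) auto

lemma sets_natural_filtration:
  "sets (natural_filtration \<Omega> M X n) =
    sigma_sets (space \<Omega>) (\<Union>i\<in>{1..n}. {X i -` A \<inter> space \<Omega> | A. A \<in> sets M})"
  unfolding natural_filtration_def by (rule sets_measure_of) auto

lemma subalgebra_natural_filtration:
  assumes "\<And>i. i \<in> {1..n} \<Longrightarrow> X i \<in> \<Omega> \<rightarrow>\<^sub>M M"
  shows "subalgebra \<Omega> (natural_filtration \<Omega> M X n)"
  unfolding subalgebra_def space_natural_filtration sets_natural_filtration
  using measurable_sets[OF assms] by (intro conjI refl sets.sigma_sets_subset) auto

lemma measurable_natural_filtration:
  assumes X: "X i \<in> \<Omega> \<rightarrow>\<^sub>M M" and i: "i \<in> {1..n}"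
  shows "X i \<in> natural_filtration \<Omega> M X n \<rightarrow>\<^sub>M M"
proof (rule measurableI)
  show "X i \<omega> \<in> space M" if "\<omega> \<in> space (natural_filtration \<Omega> M X n)" for \<omega>
    using measurable_space[OF X] that by (simp add: space_natural_filtration)
  show "X i -` A \<inter> space (natural_filtration \<Omega> M X n) \<in> sets (natural_filtration \<Omega> M X n)"
    if "A \<in> sets M" for A
    unfolding space_natural_filtration sets_natural_filtration
    using that i by (intro sigma_sets.Basic UN_I[of i]) auto
qed

lemma sets_natural_filtration_mono:
  "m \<le> n \<Longrightarrow> sets (natural_filtration \<Omega> M X m) \<subseteq> sets (natural_filtration \<Omega> M X n)"
  unfolding sets_natural_filtration by (intro sigma_sets_subseteq UN_mono) auto

lemma bounded_fun_natural_filtration_mono: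
  assumes "G \<in> bounded_fun (natural_filtration \<Omega> M X m)" "m \<le> n"
  shows "G \<in> bounded_fun (natural_filtration \<Omega> M X n)"
proof -
  have "subalgebra (natural_filtration \<Omega> M X n) (natural_filtration \<Omega> M X m)"
    using sets_natural_filtration_mono[OF assms(2)] by (simp add: subalgebra_def space_natural_filtration)
  from measurable_from_subalg[OF this] show ?thesis
    using assms(1) by (auto simp: bounded_fun_def space_natural_filtration)
qed

text \<open>The chain is specified through conditional probabilities of single sets. Taking the
  nonnegative weight G as a density on \<open>\<Omega>\<close> turns the passage from sets to
  functions h into an equality of two measures on M, which has to be checked on sets only.\<close>

lemma markov_chain_step:
  assumes mc: "markov_chain \<Omega> M P \<nu> X" and n: "n \<ge> 1"
    and G: "G \<in> bounded_fun (natural_filtration \<Omega> M X n)" "\<And>\<omega>. \<omega> \<in> space \<Omega> \<Longrightarrow> G \<omega> \<ge> 0"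
    and h: "h \<in> bounded_fun M" "\<And>x. x \<in> space M \<Longrightarrow> h x \<ge> 0"
  shows "(\<integral>\<omega>. G \<omega> * h (X (Suc n) \<omega>) \<partial>\<Omega>) = (\<integral>\<omega>. G \<omega> * markov_op P h (X n \<omega>) \<partial>\<Omega>)"
proof -
  define F where "F = natural_filtration \<Omega> M X n"
  interpret prob_space \<Omega> using mc by (simp add: markov_chain_def)
  have P: "P \<in> M \<rightarrow>\<^sub>M prob_algebra M" using mc by (simp add: markov_chain_def)
  have P': "P \<in> M \<rightarrow>\<^sub>M subprob_algebra M" using P by (rule measurable_prob_algebraD)
  have X: "X i \<in> \<Omega> \<rightarrow>\<^sub>M M" if "i \<ge> 1" for i using mc that by (simp add: markov_chain_def)
  note [measurable] = X[OF n] X[of "Suc n", simplified]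
  have sub: "subalgebra \<Omega> F" unfolding F_def by (rule subalgebra_natural_filtration) (simp add: X)
  interpret F: finite_measure_subalgebra \<Omega> F by unfold_locales (rule sub)
  have GF: "G \<in> borel_measurable F" using G(1) by (auto simp: F_def dest: bounded_fun_measurable)
  have Gb: "G \<in> bounded_fun \<Omega>"
    using G(1) measurable_from_subalg[OF sub GF] by (auto simp: bounded_fun_def space_natural_filtration)
  note [measurable] = bounded_fun_measurable[OF Gb]
  have ne: "space M \<noteq> {}" using measurable_space[OF X[OF n]] not_empty by auto
  let ?D = "density \<Omega> (\<lambda>\<omega>. ennreal (G \<omega>))"
  have "distr ?D M (X (Suc n)) = distr ?D M (X n) \<bind> P"
  proof (rule measure_eqI)
    have "sets (distr ?D M (X n) \<bind> P) = sets M"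
      using ne P' by (intro sets_bind) (auto simp: Giry_Monad.sets_kernel)
    then show "sets (distr ?D M (X (Suc n))) = sets (distr ?D M (X n) \<bind> P)" by simp
    fix B assume "B \<in> sets (distr ?D M (X (Suc n)))"
    then have B [measurable]: "B \<in> sets M" by simp
    have prob: "measure (P (X n \<omega>)) B \<ge> 0" "emeasure (P (X n \<omega>)) B = ennreal (measure (P (X n \<omega>)) B)"
      "measure (P (X n \<omega>)) B \<le> 1" if "\<omega> \<in> space \<Omega>" for \<omega>
    proof -
      have "X n \<omega> \<in> space M" using that by (rule measurable_space[OF X[OF n]])
      then interpret Px: prob_space "P (X n \<omega>)"
        using measurable_space[OF P] by (simp add: space_prob_algebra)
      show "measure (P (X n \<omega>)) B \<ge> 0" "emeasure (P (X n \<omega>)) B = ennreal (measure (P (X n \<omega>)) B)"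
        "measure (P (X n \<omega>)) B \<le> 1" by (auto simp: Px.emeasure_eq_measure)
    qed
    have mP [measurable]: "(\<lambda>\<omega>. measure (P (X n \<omega>)) B) \<in> borel_measurable \<Omega>"
      by (intro measurable_compose[OF X[OF n]] measurable_compose[OF P' measurable_measure_subprob_algebra] B)
    have ind: "(\<lambda>\<omega>. indicat_real B (X (Suc n) \<omega>)) \<in> bounded_fun \<Omega>"
      by (rule bounded_funI[of _ _ 1]) (auto simp: indicator_def)
    have mPb: "(\<lambda>\<omega>. measure (P (X n \<omega>)) B) \<in> bounded_fun \<Omega>"
      by (rule bounded_funI[of _ _ 1]) (use mP prob in auto)
    have AE: "AE \<omega> in \<Omega>. real_cond_exp \<Omega> F (\<lambda>\<omega>'. indicat_real B (X (Suc n) \<omega>')) \<omega> = measure (P (X n \<omega>)) B"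
      using mc n B unfolding markov_chain_def F_def by blast
    have "emeasure (distr ?D M (X (Suc n))) B = emeasure ?D (X (Suc n) -` B \<inter> space \<Omega>)"
      by (simp add: emeasure_distr)
    also have "\<dots> = (\<integral>\<^sup>+\<omega>. ennreal (G \<omega> * indicat_real B (X (Suc n) \<omega>)) \<partial>\<Omega>)"
      by (subst emeasure_density) (auto intro!: nn_integral_cong simp: indicator_def)
    also have "\<dots> = ennreal (\<integral>\<omega>. G \<omega> * indicat_real B (X (Suc n) \<omega>) \<partial>\<Omega>)"
      using G(2) by (intro nn_integral_eq_integral integrable_bounded_fun bounded_fun_mult Gb ind AE_I2) auto
    \<comment> \<open>The weight depends on the past up to time n only, so the indicator may be
      replaced by its conditional expectation.\<close>
    also have "(\<integral>\<omega>. G \<omega> * indicat_real B (X (Suc n) \<omega>) \<partial>\<Omega>)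
        = (\<integral>\<omega>. G \<omega> * real_cond_exp \<Omega> F (\<lambda>\<omega>'. indicat_real B (X (Suc n) \<omega>')) \<omega> \<partial>\<Omega>)"
      by (intro F.real_cond_exp_intg(2)[symmetric] GF integrable_bounded_fun bounded_fun_mult Gb ind) measurable
    also have "\<dots> = (\<integral>\<omega>. G \<omega> * measure (P (X n \<omega>)) B \<partial>\<Omega>)"
      using AE by (intro integral_cong_AE) (auto elim: eventually_mono)
    also have "ennreal \<dots> = (\<integral>\<^sup>+\<omega>. ennreal (G \<omega> * measure (P (X n \<omega>)) B) \<partial>\<Omega>)"
      using G(2) by (intro nn_integral_eq_integral[symmetric] integrable_bounded_fun bounded_fun_mult Gb mPb AE_I2) auto
    also have "\<dots> = (\<integral>\<^sup>+\<omega>. ennreal (G \<omega>) * emeasure (P (X n \<omega>)) B \<partial>\<Omega>)"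
      using G(2) prob by (intro nn_integral_cong) (simp add: ennreal_mult)
    also have "\<dots> = (\<integral>\<^sup>+x. emeasure (P x) B \<partial>distr ?D M (X n))"
      using P' B by (simp add: nn_integral_distr nn_integral_density measurable_emeasure_kernel measurable_compose[OF X[OF n]])
    also have "\<dots> = emeasure (distr ?D M (X n) \<bind> P) B"
      using ne P' by (intro emeasure_bind[where N = M, symmetric]) auto
    finally show "emeasure (distr ?D M (X (Suc n))) B = emeasure (distr ?D M (X n) \<bind> P) B" .
  qed
  then have "(\<integral>\<^sup>+x. ennreal (h x) \<partial>distr ?D M (X (Suc n))) = (\<integral>\<^sup>+x. ennreal (h x) \<partial>(distr ?D M (X n) \<bind> P))"
    by simp
  also have "\<dots> = (\<integral>\<^sup>+x. \<integral>\<^sup>+y. ennreal (h y) \<partial>P x \<partial>distr ?D M (X n))"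
    using P' bounded_fun_measurable[OF h(1)] by (intro nn_integral_bind[where B = M]) auto
  also have "\<dots> = (\<integral>\<^sup>+x. ennreal (markov_op P h x) \<partial>distr ?D M (X n))"
  proof (rule nn_integral_cong)
    fix x assume "x \<in> space (distr ?D M (X n))"
    then have x: "x \<in> space M" by simp
    have Px: "prob_space (P x)" and sets: "sets (P x) = sets M"
      using measurable_space[OF P x] by (auto simp: space_prob_algebra)
    have "h \<in> bounded_fun (P x)" using h(1) bounded_fun_cong_sets[OF sets] by blast
    then show "(\<integral>\<^sup>+y. ennreal (h y) \<partial>P x) = ennreal (markov_op P h x)"
      unfolding markov_op_def using h(2) sets_eq_imp_space_eq[OF sets]
      by (intro nn_integral_eq_integral prob_space.integrable_bounded_fun[OF Px] AE_I2) auto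
  qed
  finally have eq: "(\<integral>\<^sup>+x. ennreal (h x) \<partial>distr ?D M (X (Suc n))) = (\<integral>\<^sup>+x. ennreal (markov_op P h x) \<partial>distr ?D M (X n))" .
  have conv: "(\<integral>\<^sup>+x. ennreal (\<phi> x) \<partial>distr ?D M (X i)) = ennreal (\<integral>\<omega>. G \<omega> * \<phi> (X i \<omega>) \<partial>\<Omega>)"
    if \<phi>: "\<phi> \<in> bounded_fun M" "\<And>x. x \<in> space M \<Longrightarrow> \<phi> x \<ge> 0" and i: "i \<ge> 1" for \<phi> i
  proof -
    note [measurable] = X[OF i] bounded_fun_measurable[OF \<phi>(1)]
    have "(\<integral>\<^sup>+x. ennreal (\<phi> x) \<partial>distr ?D M (X i)) = (\<integral>\<^sup>+\<omega>. ennreal (G \<omega>) * ennreal (\<phi> (X i \<omega>)) \<partial>\<Omega>)"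
      by (simp add: nn_integral_distr nn_integral_density)
    also have "\<dots> = (\<integral>\<^sup>+\<omega>. ennreal (G \<omega> * \<phi> (X i \<omega>)) \<partial>\<Omega>)"
      using G(2) \<phi>(2) measurable_space[OF X[OF i]] by (intro nn_integral_cong) (simp add: ennreal_mult)
    also have "\<dots> = ennreal (\<integral>\<omega>. G \<omega> * \<phi> (X i \<omega>) \<partial>\<Omega>)"
      using G(2) \<phi>(2) measurable_space[OF X[OF i]]
      by (intro nn_integral_eq_integral integrable_bounded_fun bounded_fun_mult Gb bounded_fun_compose[OF \<phi>(1) X[OF i]] AE_I2) auto
    finally show ?thesis .
  qed
  have Ph: "markov_op P h x \<ge> 0" if "x \<in> space M" for x
  proof -
    have "space (P x) = space M"
      using measurable_space[OF P that] by (auto simp: space_prob_algebra dest: sets_eq_imp_space_eq)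
    then show ?thesis unfolding markov_op_def using h(2) by (intro Bochner_Integration.integral_nonneg) simp
  qed
  have "ennreal (\<integral>\<omega>. G \<omega> * h (X (Suc n) \<omega>) \<partial>\<Omega>) = ennreal (\<integral>\<omega>. G \<omega> * markov_op P h (X n \<omega>) \<partial>\<Omega>)"
    using eq conv[OF h, of "Suc n"] conv[OF bounded_fun_markov_op[OF P h(1)] Ph n] by simp
  then show ?thesis
    using G(2) h(2) Ph measurable_space[OF X[OF n]] measurable_space[OF X[of "Suc n"]]
    by (subst (asm) ennreal_inj) (auto intro!: Bochner_Integration.integral_nonneg)
qed

text \<open>The weight G carries the past and must be arbitrary in the induction: the factor exp (g
  k (X k)) is absorbed into it before passing to time k + 1, and the one-step Markov property then
  returns from X (k + 1) to X k.\<close>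

lemma markov_chain_expectation_fk:
  assumes mc: "markov_chain \<Omega> M P \<nu> X"
  shows "k \<ge> 1 \<Longrightarrow> (\<And>i. i \<in> {k..<k + m} \<Longrightarrow> g i \<in> bounded_fun M) \<Longrightarrow>
    G \<in> bounded_fun (natural_filtration \<Omega> M X k) \<Longrightarrow> (\<And>\<omega>. \<omega> \<in> space \<Omega> \<Longrightarrow> G \<omega> \<ge> 0) \<Longrightarrow>
    (\<integral>\<omega>. G \<omega> * exp (\<Sum>i\<in>{k..<k + m}. g i (X i \<omega>)) \<partial>\<Omega>) = (\<integral>\<omega>. G \<omega> * fk P g m k (X k \<omega>) \<partial>\<Omega>)"
proof (induction m arbitrary: k G)
  case (Suc m)
  have P: "P \<in> M \<rightarrow>\<^sub>M prob_algebra M" using mc by (simp add: markov_chain_def)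
  have X: "X k \<in> \<Omega> \<rightarrow>\<^sub>M M" using mc Suc.prems(1) by (simp add: markov_chain_def)
  define G' where "G' \<omega> = G \<omega> * exp (g k (X k \<omega>))" for \<omega>
  have gk: "g k \<in> bounded_fun M" by (rule Suc.prems(2)) simp
  have G': "G' \<in> bounded_fun (natural_filtration \<Omega> M X k)"
    unfolding G'_def using Suc.prems(1)
    by (intro bounded_fun_mult Suc.prems bounded_fun_exp bounded_fun_compose[OF gk] measurable_natural_filtration X) auto
  have G'_nonneg: "G' \<omega> \<ge> 0" if "\<omega> \<in> space \<Omega>" for \<omega> using Suc.prems(4)[OF that] by (simp add: G'_def)
  have g: "g i \<in> bounded_fun M" if "i \<in> {Suc k..<Suc k + m}" for i using that by (intro Suc.prems) auto
  have "(\<integral>\<omega>. G \<omega> * exp (\<Sum>i\<in>{k..<k + Suc m}. g i (X i \<omega>)) \<partial>\<Omega>)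
      = (\<integral>\<omega>. G' \<omega> * exp (\<Sum>i\<in>{Suc k..<Suc k + m}. g i (X i \<omega>)) \<partial>\<Omega>)"
  proof -
    have "(\<Sum>i\<in>{k..<k + Suc m}. g i (X i \<omega>)) = g k (X k \<omega>) + (\<Sum>i\<in>{Suc k..<Suc k + m}. g i (X i \<omega>))" for \<omega>
      by (subst sum.atLeast_Suc_lessThan) simp_all
    then show ?thesis by (simp only: G'_def exp_add mult.assoc)
  qed
  also have "\<dots> = (\<integral>\<omega>. G' \<omega> * fk P g m (Suc k) (X (Suc k) \<omega>) \<partial>\<Omega>)"
    by (intro Suc.IH g bounded_fun_natural_filtration_mono[OF G'] G'_nonneg) auto
  also have "\<dots> = (\<integral>\<omega>. G' \<omega> * markov_op P (fk P g m (Suc k)) (X k \<omega>) \<partial>\<Omega>)"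
    by (intro markov_chain_step[OF mc] Suc.prems(1) G' G'_nonneg bounded_fun_fk[OF P] g
        less_imp_le[OF fk_pos[OF P]])
  finally show ?case by (simp add: G'_def mult.assoc)
qed simp

section \<open>Exponential moments and tail bounds\<close>

text \<open>The conditional in the tail bound fixes the degenerate case of a zero denominator:
  division by 0 yields 0 in HOL, so the plain formula would give exp 0 = 1, whereas the limiting
  value is exp (-\<infinity>) = 0.\<close>

theorem theorem2p3:
  fixes M \<pi> \<nu> :: "'a measure" and \<Omega> :: "'w measure"
    and P :: "'a \<Rightarrow> 'a measure" and X :: "nat \<Rightarrow> 'w \<Rightarrow> 'a"
    and p :: ennreal and n :: nat
    and f :: "nat \<Rightarrow> 'a \<Rightarrow> real" and a b :: "nat \<Rightarrow> real"
  defines "l \<equiv> spectral_lambda \<pi> P" and "q \<equiv> conjugate_exponent p"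
    and "N \<equiv> enn2real (density_norm \<pi> \<nu> p)"
  assumes "standard_borel M"
    and "markov_chain \<Omega> M P \<nu> X"
    and "prob_space \<pi>" and "sets \<pi> = sets M" and "invariant_measure P \<pi>"
    and "1 - l > 0"
    and "absolutely_continuous \<pi> \<nu>"
    and "1 < p" and "density_norm \<pi> \<nu> p < \<infinity>"
    and "n \<ge> 1"
    and "\<And>i. i \<in> {1..n} \<Longrightarrow> f i \<in> borel_measurable M"
    and "\<And>i. i \<in> {1..n} \<Longrightarrow> f i \<in> space M \<rightarrow> {a i..b i}"
  shows "(\<forall>t::real.
            (\<integral>\<omega>. exp (t * (\<Sum>i=1..n. f i (X i \<omega>) - (\<integral>x. f i x \<partial>\<pi>))) \<partial>\<Omega>)
              \<le> N * exp (t\<^sup>2 / 2 * (q * alpha l) * (\<Sum>i=1..n. (b i - a i)\<^sup>2 / 4))) \<and>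
         (\<forall>\<epsilon>>0::real.
            measure \<Omega> {\<omega> \<in> space \<Omega>.
                \<bar>(\<Sum>i=1..n. f i (X i \<omega>)) - (\<Sum>i=1..n. \<integral>x. f i x \<partial>\<pi>)\<bar> > \<epsilon>}
              \<le> 2 * N *
                (if (\<Sum>i=1..n. (b i - a i)\<^sup>2 / 4) = 0 then 0
                 else exp (- (inverse q * inverse (alpha l) * \<epsilon>\<^sup>2
                               / (2 * (\<Sum>i=1..n. (b i - a i)\<^sup>2 / 4))))))"
proof -
  note mc = assms(5) and sets = assms(7) and ac = assms(10) and p = assms(11,12)
    and fm = assms(14) and fab = assms(15)
  have P: "P \<in> M \<rightarrow>\<^sub>M prob_algebra M" and \<nu>: "distr \<Omega> M (X 1) = \<nu>"
    and X: "\<And>i. i \<ge> 1 \<Longrightarrow> X i \<in> \<Omega> \<rightarrow>\<^sub>M M"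
    using mc by (simp_all add: markov_chain_def)
  have P\<pi>: "P \<in> \<pi> \<rightarrow>\<^sub>M prob_algebra \<pi>"
    using P unfolding prob_algebra_def subprob_algebra_cong[OF sets] measurable_cong_sets[OF sets refl] .
  have space: "space \<pi> = space M" by (rule sets_eq_imp_space_eq[OF sets])
  have bounded: "bounded_fun \<pi> = bounded_fun M" by (rule bounded_fun_cong_sets[OF sets])
  interpret \<Omega>: prob_space \<Omega> using mc by (simp add: markov_chain_def)
  interpret \<nu>: prob_space \<nu> using \<Omega>.prob_space_distr[OF X[OF order_refl]] unfolding \<nu> .
  interpret \<pi>: stationary_kernel \<pi> P
    using assms(6,8) P\<pi> by (simp add: stationary_kernel_def stationary_kernel_axioms_def)
  have l1: "spectral_lambda \<pi> P < 1" using assms(9) by (simp add: l_def)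
  have \<alpha>: "alpha l \<ge> 1"
    using \<pi>.spectral_lambda_nonneg l1 by (intro alpha_ge_1) (simp_all add: l_def)
  have q: "q \<ge> 1"
  proof (cases "p = \<infinity>")
    case False
    then have "p = ennreal (enn2real p)" by (simp add: less_top)
    then have "enn2real p > 1" using p(1) by (metis ennreal_1 ennreal_less_iff zero_le_one)
    then show ?thesis using False by (simp add: q_def conjugate_exponent_def)
  qed (simp add: q_def conjugate_exponent_def)
  have fb: "f i \<in> bounded_fun M" if "i \<in> {1..n}" for i
    using fm[OF that] fab[OF that]
    by (intro bounded_funI[of _ _ "max \<bar>a i\<bar> \<bar>b i\<bar>"]) (fastforce simp: Pi_iff)+
  define \<mu> where "\<mu> i = (\<integral>x. f i x \<partial>\<pi>)" for i
  define S where "S \<omega> = (\<Sum>i=1..n. f i (X i \<omega>) - \<mu> i)" for \<omega>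
  define V where "V = (\<Sum>i=1..n. (b i - a i)\<^sup>2 / 4)"
  have interval: "{1..<1 + n} = {1..n}" by auto
  have Sb: "(\<lambda>\<omega>. S \<omega>) \<in> bounded_fun \<Omega>"
  proof -
    have "(\<lambda>\<omega>. \<Sum>i\<in>I. f i (X i \<omega>) - \<mu> i) \<in> bounded_fun \<Omega>" if "finite I" "I \<subseteq> {1..n}" for I
      using that
      by (induction I rule: finite_induct) (auto intro!: bounded_fun_intros bounded_fun_compose[OF fb X])
    then show ?thesis by (simp add: S_def)
  qed
  have mgf: "(\<integral>\<omega>. exp (t * S \<omega>) \<partial>\<Omega>) \<le> N * exp (t\<^sup>2 / 2 * (q * alpha l) * V)" for t :: real
  proof -
    define g where "g i x = t * (f i x - \<mu> i)" for i x
    define h where "h i x = q * g i x" for i x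
    \<comment> \<open>Minimum and maximum are needed because a negative t reverses the
      endpoints.\<close>
    define A where "A i = min (q * t * (a i - \<mu> i)) (q * t * (b i - \<mu> i))" for i
    define B where "B i = max (q * t * (a i - \<mu> i)) (q * t * (b i - \<mu> i))" for i
    have gb: "g i \<in> bounded_fun M" if "i \<in> {1..<1 + n}" for i
      unfolding g_def using that by (intro bounded_fun_intros fb) auto
    have hb: "h i \<in> bounded_fun M" if "i \<in> {1..<1 + n}" for i
      unfolding h_def by (intro bounded_fun_cmult gb that)
    have hAB: "h i x \<in> {A i..B i}" if "i \<in> {1..<1 + n}" "x \<in> space \<pi>" for i x
    proof -
      have "f i x \<in> {a i..b i}" using fab[of i] that by (auto simp: space)
      then have "q * t * (f i x - \<mu> i) \<in> {A i..B i}"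
        by (cases "q * t \<ge> 0") (auto simp: A_def B_def min_le_iff_disj le_max_iff_disj mult_left_mono mult_left_mono_neg)
      then show ?thesis by (simp add: h_def g_def mult.assoc)
    qed
    have h0: "\<pi>.expectation (h i) = 0" if "i \<in> {1..<1 + n}" for i
      using that fb[of i]
      by (simp add: h_def[abs_def] g_def \<mu>_def \<pi>.integrable_bounded_fun bounded \<pi>.prob_space)
    have BA: "(B i - A i)\<^sup>2 / 8 = (q * t)\<^sup>2 / 2 * ((b i - a i)\<^sup>2 / 4)" for i
    proof -
      have "(B i - A i)\<^sup>2 = (q * t * (b i - \<mu> i) - q * t * (a i - \<mu> i))\<^sup>2"
        by (auto simp: A_def B_def min_def max_def power2_commute)
      also have "\<dots> = (q * t)\<^sup>2 * (b i - a i)\<^sup>2"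
        by (simp flip: power_mult_distrib right_diff_distrib)
      finally show ?thesis by simp
    qed
    let ?v = "fk P g n 1" and ?w = "fk P h n 1"
    have v: "?v \<in> bounded_fun M" by (rule bounded_fun_fk[OF P gb])
    have v_pos: "?v x \<ge> 0" if "x \<in> space M" for x by (rule less_imp_le[OF fk_pos[OF P gb that]])
    have w: "?w \<in> bounded_fun M" by (rule bounded_fun_fk[OF P hb])
    have vw: "?v x powr q \<le> ?w x" if "x \<in> space \<pi>" for x
      unfolding h_def using gb that by (intro \<pi>.fk_powr_le q) (simp_all add: bounded)
    have vq: "integrable \<pi> (\<lambda>x. ?v x powr q)"
    proof (rule Bochner_Integration.integrable_bound[OF \<pi>.integrable_bounded_fun])
      show "?w \<in> bounded_fun \<pi>" using w by (simp add: bounded)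
      show "(\<lambda>x. ?v x powr q) \<in> borel_measurable \<pi>"
        using v bounded_fun_measurable[of ?v \<pi>] by (simp add: bounded)
      show "AE x in \<pi>. norm (?v x powr q) \<le> norm (?w x)"
        using vw by (intro AE_I2) fastforce
    qed
    have "(\<integral>\<omega>. exp (t * S \<omega>) \<partial>\<Omega>) = (\<integral>\<omega>. 1 * exp (\<Sum>i\<in>{1..<1 + n}. g i (X i \<omega>)) \<partial>\<Omega>)"
      by (simp only: interval) (simp add: S_def g_def sum_distrib_left)
    also have "\<dots> = (\<integral>\<omega>. 1 * ?v (X 1 \<omega>) \<partial>\<Omega>)"
      by (rule markov_chain_expectation_fk[OF mc _ gb]) (auto intro: bounded_fun_const)
    also have "\<dots> = (\<integral>x. ?v x \<partial>\<nu>)"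
      using bounded_fun_measurable[OF v] X[of 1] by (simp add: integral_distr flip: \<nu>)
    \<comment> \<open>The passage from the initial law to the stationary one; everything after it
      takes place under \<open>\<pi>\<close>.\<close>
    also have "\<dots> \<le> N * (\<pi>.expectation (\<lambda>x. ?v x powr q)) powr (1 / q)"
      unfolding N_def q_def using v v_pos
      by (intro \<pi>.integral_le_density_norm ac p \<nu>.finite_measure_axioms) (simp_all add: sets bounded space flip: \<nu>)
    also have "\<dots> \<le> N * (\<pi>.expectation ?w) powr (1 / q)"
      using q w
      by (intro mult_left_mono powr_mono2 integral_mono vq vw \<pi>.integrable_bounded_fun
          Bochner_Integration.integral_nonneg) (simp_all add: bounded N_def)
    also have "\<dots> \<le> N * exp (alpha l * (\<Sum>i\<in>{1..<1 + n}. (B i - A i)\<^sup>2 / 8)) powr (1 / q)"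
    proof (intro mult_left_mono powr_mono2)
      show "\<pi>.expectation ?w \<le> exp (alpha l * (\<Sum>i\<in>{1..<1 + n}. (B i - A i)\<^sup>2 / 8))"
        unfolding l_def using hb hAB h0
        by (intro \<pi>.expectation_fk_le l1) (auto simp flip: bounded intro: bounded_fun_measurable)
      show "0 \<le> \<pi>.expectation ?w"
        using fk_pos[OF P hb] by (intro Bochner_Integration.integral_nonneg) (simp add: space less_imp_le)
    qed (use q in \<open>auto simp: N_def\<close>)
    also have "exp (alpha l * (\<Sum>i\<in>{1..<1 + n}. (B i - A i)\<^sup>2 / 8)) powr (1 / q)
        = exp (t\<^sup>2 / 2 * (q * alpha l) * V)"
    proof -
      have "(\<Sum>i\<in>{1..<1 + n}. (B i - A i)\<^sup>2 / 8) = (q * t)\<^sup>2 / 2 * V"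
        unfolding interval BA V_def by (rule sum_distrib_left[symmetric])
      \<comment> \<open>Scaling the functions by q produces q^2 and the root 1 / q removes one
        factor, which leaves the q of the final exponent.\<close>
      moreover have "alpha l * ((q * t)\<^sup>2 / 2 * V) * (1 / q) = t\<^sup>2 / 2 * (q * alpha l) * V"
        using q by (simp add: power2_eq_square)
      ultimately show ?thesis by (simp only: exp_powr_real)
    qed
    finally show ?thesis .
  qed
  have dev: "(\<Sum>i=1..n. f i (X i \<omega>)) - (\<Sum>i=1..n. \<mu> i) = S \<omega>" for \<omega>
    by (simp add: S_def sum_subtractf)
  have tail: "measure \<Omega> {\<omega> \<in> space \<Omega>. \<bar>S \<omega>\<bar> > \<epsilon>}
      \<le> 2 * N * (if V = 0 then 0 else exp (- (inverse q * inverse (alpha l) * \<epsilon>\<^sup>2 / (2 * V))))"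
    if \<epsilon>: "\<epsilon> > 0" for \<epsilon> :: real
  proof (cases "V = 0")
    case True
    have S0: "S \<omega> = 0" if \<omega>: "\<omega> \<in> space \<Omega>" for \<omega>
      unfolding S_def
    proof (rule sum.neutral, rule ballI)
      fix i assume i: "i \<in> {1..n}"
      have "a i = b i"
        using True i unfolding V_def by (subst (asm) sum_nonneg_eq_0_iff) auto
      then have fi: "f i x = a i" if "x \<in> space M" for x using fab[OF i] that by fastforce
      have "\<mu> i = (\<integral>x. a i \<partial>\<pi>)"
        unfolding \<mu>_def by (intro Bochner_Integration.integral_cong refl fi) (simp add: space)
      moreover have "X i \<omega> \<in> space M" using measurable_space[OF X \<omega>] i by simp
      ultimately show "f i (X i \<omega>) - \<mu> i = 0" by (simp add: fi \<pi>.prob_space)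
    qed
    have "{\<omega> \<in> space \<Omega>. \<bar>S \<omega>\<bar> > \<epsilon>} = {}" using S0 \<epsilon> by auto
    then have "measure \<Omega> {\<omega> \<in> space \<Omega>. \<bar>S \<omega>\<bar> > \<epsilon>} = 0" by (simp only: measure_empty)
    then show ?thesis using True by simp
  next
    case False
    have V: "V > 0"
      using False sum_nonneg[of "{1..n}" "\<lambda>i. (b i - a i)\<^sup>2 / 4"] by (simp add: V_def)
    define c where "c = q * alpha l * V"
    have c: "c > 0" using q \<alpha> V by (simp add: c_def)
    \<comment> \<open>The minimiser of s^2 * c / 2 - s * \<epsilon>, with minimum -\<epsilon>^2 / (2
      * c).\<close>
    define s where "s = \<epsilon> / c"
    have s: "s > 0" using c \<epsilon> by (simp add: s_def)
    have expo: "exp (- s * \<epsilon>) * (N * exp (s\<^sup>2 / 2 * (q * alpha l) * V)) = N * exp (- (\<epsilon>\<^sup>2 / (2 * c)))"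
    proof -
      have "- s * \<epsilon> + s\<^sup>2 / 2 * c = - (\<epsilon>\<^sup>2 / (2 * c))"
        using c by (simp add: s_def power2_eq_square field_simps)
      then show ?thesis by (simp add: c_def mult.assoc flip: exp_add)
    qed
    have Sm [measurable]: "S \<in> borel_measurable \<Omega>" using bounded_fun_measurable[OF Sb] by simp
    have int: "set_integrable \<Omega> (space \<Omega>) (\<lambda>\<omega>. exp (r * S \<omega>))" for r
      unfolding set_integrable_def
      by (intro integrable_mult_indicator \<Omega>.integrable_bounded_fun bounded_fun_exp bounded_fun_cmult) (use Sb in auto)
    have setint: "(\<integral>\<omega>\<in>space \<Omega>. exp (r * S \<omega>) \<partial>\<Omega>) = (\<integral>\<omega>. exp (r * S \<omega>) \<partial>\<Omega>)" for r
      by (rule set_integral_space) (intro \<Omega>.integrable_bounded_fun bounded_fun_exp bounded_fun_cmult Sb)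
    have "measure \<Omega> {\<omega> \<in> space \<Omega>. S \<omega> \<ge> \<epsilon>} \<le> exp (- s * \<epsilon>) * (\<integral>\<omega>. exp (s * S \<omega>) \<partial>\<Omega>)"
      using \<Omega>.Chernoff_ineq_ge[OF s int, of \<epsilon>] by (simp add: setint)
    also have "\<dots> \<le> exp (- s * \<epsilon>) * (N * exp (s\<^sup>2 / 2 * (q * alpha l) * V))"
      by (intro mult_left_mono mgf) simp
    finally have upper: "measure \<Omega> {\<omega> \<in> space \<Omega>. S \<omega> \<ge> \<epsilon>} \<le> N * exp (- (\<epsilon>\<^sup>2 / (2 * c)))"
      unfolding expo .
    \<comment> \<open>The lower tail uses the moment bound at -s; that bound depends on the square
      only, so both tails agree.\<close>
    have "measure \<Omega> {\<omega> \<in> space \<Omega>. S \<omega> \<le> - \<epsilon>} \<le> exp (s * - \<epsilon>) * (\<integral>\<omega>. exp (- s * S \<omega>) \<partial>\<Omega>)"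
      using \<Omega>.Chernoff_ineq_le[OF s int, of "- \<epsilon>"] setint[of "- s"] by simp
    also have "\<dots> \<le> exp (s * - \<epsilon>) * (N * exp ((- s)\<^sup>2 / 2 * (q * alpha l) * V))"
      by (intro mult_left_mono mgf) simp
    finally have lower: "measure \<Omega> {\<omega> \<in> space \<Omega>. S \<omega> \<le> - \<epsilon>} \<le> N * exp (- (\<epsilon>\<^sup>2 / (2 * c)))"
      unfolding expo[symmetric] by simp
    have "measure \<Omega> {\<omega> \<in> space \<Omega>. \<bar>S \<omega>\<bar> > \<epsilon>}
        \<le> measure \<Omega> ({\<omega> \<in> space \<Omega>. S \<omega> \<ge> \<epsilon>} \<union> {\<omega> \<in> space \<Omega>. S \<omega> \<le> - \<epsilon>})"
      by (intro \<Omega>.finite_measure_mono) auto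
    also have "\<dots> \<le> measure \<Omega> {\<omega> \<in> space \<Omega>. S \<omega> \<ge> \<epsilon>} + measure \<Omega> {\<omega> \<in> space \<Omega>. S \<omega> \<le> - \<epsilon>}"
      by (intro measure_Un_le) measurable
    also have "\<dots> \<le> 2 * N * exp (- (\<epsilon>\<^sup>2 / (2 * c)))" using upper lower by simp
    also have "\<epsilon>\<^sup>2 / (2 * c) = inverse q * inverse (alpha l) * \<epsilon>\<^sup>2 / (2 * V)"
      using q \<alpha> V by (simp add: c_def field_simps)
    finally show ?thesis using False by simp
  qed
  show ?thesis
    unfolding \<mu>_def[symmetric] S_def[symmetric] V_def[symmetric] dev using mgf tail by blast
qed

end
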